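(* Let $s$ be a $4$-valent unlabeled scheme (virtually-rooted or not) of a surface $\mathbb{S}$, i.e. $s\in\mathcal{U}^\times_{\mathbb{S}}$. - Any offset cycle of $s$ has length at most $2$, and consists of consecutive forward edges in the tour of $s$. In particular, an orientable labeled scheme has no offset cycle. - Additionally, all these cycles are pairwise disjoint, and the total length of cycles in the offset graph of any labeled scheme is at most equal to $2 g_{\mathbb{S}}$, where $g_{\mathbb{S}}$ is the genus of $\mathbb{S}$.
   Context: **Maps.** A surface $\mathbb{S}$ is a compact connected two-dimensional real manifold (without boundary, orientable or not), of Euler characteristic $\chi_{\mathbb S}=2-2g_{\mathbb S}$, where $g_{\mathbb S}\in\frac12\mathbb{N}$ is its genus. A map of $\mathbb{S}$ is a cellular embedding of a graph (loops and multiple edges allowed) in $\mathbb{S}$ (all faces simply connected) up to homeomorphism, rooted at an oriented corner $\rho$. A corner is a vertex–face adjacency delimited by two consecutive halfedges around the vertex; an oriented corner is a corner with a choice of rotation direction around its vertex. $\sigma(c)$ is the next corner around the vertex in the chosen direction; the halfedge following $c$ separates $c$ from $\sigma(c)$; if it belongs to an edge, $\theta(c)$ is the next oriented corner reached by following this edge along the face of $c$. **Blossoming maps and tour.** A blossoming map is a map with additional dangling halfedges called stems, each a bud or a leaf; here the numbers of buds and leaves need not agree (unbalanced). If $c$ is followed by a stem, $\theta(c)=\sigma(c)$. The interior degree of a vertex is its number of incident non-stem halfedges. In a unicellular (one-face) blossoming map, the tour $\rho,\theta(\rho),\theta^2(\rho),\dots$ visits each corner once and traverses each edge twice. Visiting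 order of corners: $\theta(\rho)$ is first and $\rho$ is last. An edge is forward if the tour traverses it twice in the same direction, backward otherwise. **Decent labelings.** A decent labeling of a unicellular blossoming map is an integer labeling $\lambda$ of its corners with: $\lambda(\rho)=0$; when the tour crosses a bud (resp. a leaf) from $c$ to $\sigma(c)$, $\lambda(\sigma(c))=\lambda(c)+1$ (resp. $\lambda(c)-1$); for each halfedge belonging to an edge, of the two corners separated by this halfedge at its vertex, the one visited later has label smaller by exactly $1$ than the one visited earlier. (Labels need not be constant along sides of edges.) **Schemes.** A labeled scheme of $\mathbb{S}$ is a unicellular, possibly unbalanced, blossoming map of $\mathbb{S}$ in which every vertex has interior degree at least $3$, whose root corner is followed by a bud (the root bud), equipped with a decent labeling. It may be virtually-rooted: this means that both the bud following $\rho$ and the stem preceding $\rho$, which is also a bud, are marked as virtual, and the virtual bud following $\rho$ is not followed by a bud and the virtual bud preceding $\rho$ is not preceded by a bud. Virtual buds are not counted in vertex degrees (but behave as buds for labelings). An unlabeled scheme is what is obtained from a labeled scheme by forgetting its labeling. $\mathcal{U}^\times_{\mathbb{S}}$ is the set of $4$-valent (all vertices of degree $4$, counting non-virtual stems) unlabeled schemes of $\mathbb{S}$; labeled schemes in the statement are likewise $4$-valent. **Offset graph.** The relative labeling is $\lambda^r(c)=\lambda(c)-\min\lambda$, the minimum being over all corners at the same vertex as $c$; it depends only on the unlabeled scheme. The relative type of a halfedge is the minimum of the relative labels of its two adjacent corners (in the present situation it is $0$ or $1$). An edge with endpoints $u,v$ is offset toward $v$ if its halfedge at $u$ has relative type $0$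 and its halfedge at $v$ has relative type $1$. The offset graph is the directed graph made of the offset edges (each directed toward the vertex toward which it is offset); an offset cycle is an oriented (simple) cycle of the offset graph, loops being cycles of length $1$. *)

theory Defs
  imports Complex_Main "HOL-Library.Sublist" "Graph_Theory.Digraph" "Graph_Theory.Arc_Walk"
begin

section \<open>Blossoming maps\<close>

text \<open>
  A map on a compact connected surface, orientable or not, is encoded up to homeomorphism by its
  finite set of oriented corners (the flags of a generalized map):

  \<^item> \<open>rev_corner c\<close> is the same corner with the opposite rotation direction;
  \<^item> \<open>sig c\<close> is the next corner \<open>\<sigma>(c)\<close> around the vertex, in the direction of \<open>c\<close>;
  \<^item> if the halfedge following \<open>c\<close> belongs to an edge, \<open>opp c\<close> is the oriented corner at the other
    end of this edge which lies on the same side of the edge and is followed by the edge.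

  An oriented corner \<open>c\<close> thus also stands for one side of the halfedge following it, the other side
  being \<open>rev_corner (sig c)\<close>. The sets \<open>buds\<close> and \<open>leaves\<close> contain the oriented corners that are followed
  by a bud or by a leaf. If \<open>virtually_rooted\<close> holds, the halfedges following and
  preceding the root corner are marked as virtual.
\<close>

record 'a pre_blossoming_map =
  corners :: "'a set"
  rev_corner :: "'a \<Rightarrow> 'a"
  sig :: "'a \<Rightarrow> 'a"
  opp :: "'a \<Rightarrow> 'a"
  buds :: "'a set"
  leaves :: "'a set"
  root_corner :: 'a
  virtually_rooted :: bool

definition other_side :: "'a pre_blossoming_map \<Rightarrow> 'a \<Rightarrow> 'a" where
  "other_side s c = rev_corner s (sig s c)"

definition edge_corners :: "'a pre_blossoming_map \<Rightarrow> 'a set" where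
  "edge_corners s = corners s - (buds s \<union> leaves s)"

definition theta :: "'a pre_blossoming_map \<Rightarrow> 'a \<Rightarrow> 'a" where
  "theta s c = (if c \<in> edge_corners s then rev_corner s (opp s c) else sig s c)"

text \<open>
  The conditions on \<open>rev_corner\<close> and \<open>other_side\<close> say that the corners around a vertex form a disc,
  with two opposite rotation directions; those on \<open>opp\<close> say that each edge is a strip with four
  distinct flags (two ends and two sides).
\<close>

definition blossoming_map :: "'a pre_blossoming_map \<Rightarrow> bool" where
  "blossoming_map s \<longleftrightarrow>
     finite (corners s) \<and> root_corner s \<in> corners s \<and>
     (\<forall>c\<in>corners s. rev_corner s c \<in> corners s \<and> rev_corner s (rev_corner s c) = c \<and>
        rev_corner s c \<noteq> c) \<and>
     (\<forall>c\<in>corners s. sig s c \<in> corners s \<and> other_side s (other_side s c) = c \<and>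
        other_side s c \<noteq> c) \<and>
     buds s \<subseteq> corners s \<and> leaves s \<subseteq> corners s \<and> buds s \<inter> leaves s = {} \<and>
     (\<forall>c\<in>buds s. other_side s c \<in> buds s) \<and> (\<forall>c\<in>leaves s. other_side s c \<in> leaves s) \<and>
     (\<forall>c\<in>edge_corners s. opp s c \<in> edge_corners s \<and> opp s (opp s c) = c \<and> opp s c \<noteq> c \<and>
        opp s (other_side s c) = other_side s (opp s c) \<and> opp s c \<noteq> other_side s c) \<and>
     (\<forall>c\<in>corners s. \<forall>d\<in>corners s.
        (c, d) \<in> ({(x, rev_corner s x) |x. x \<in> corners s} \<union> {(x, sig s x) |x. x \<in> corners s}
                   \<union> {(x, opp s x) |x. x \<in> edge_corners s})\<^sup>*)"

text \<open>Vertices, halfedges, edges and faces are represented by their sets of oriented corners.\<close>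

definition vertex_of :: "'a pre_blossoming_map \<Rightarrow> 'a \<Rightarrow> 'a set" where
  "vertex_of s c =
     {d. (c, d) \<in> ({(x, rev_corner s x) |x. x \<in> corners s} \<union> {(x, sig s x) |x. x \<in> corners s})\<^sup>*}"

definition face_of :: "'a pre_blossoming_map \<Rightarrow> 'a \<Rightarrow> 'a set" where
  "face_of s c =
     {d. (c, d) \<in> ({(x, rev_corner s x) |x. x \<in> corners s} \<union> {(x, theta s x) |x. x \<in> corners s})\<^sup>*}"

definition halfedge_of :: "'a pre_blossoming_map \<Rightarrow> 'a \<Rightarrow> 'a set" where
  "halfedge_of s c = {c, other_side s c}"

definition edge_of :: "'a pre_blossoming_map \<Rightarrow> 'a \<Rightarrow> 'a set" where
  "edge_of s c = halfedge_of s c \<union> halfedge_of s (opp s c)"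

definition vertices :: "'a pre_blossoming_map \<Rightarrow> 'a set set" where
  "vertices s = vertex_of s ` corners s"

definition faces :: "'a pre_blossoming_map \<Rightarrow> 'a set set" where
  "faces s = face_of s ` corners s"

definition edges :: "'a pre_blossoming_map \<Rightarrow> 'a set set" where
  "edges s = edge_of s ` edge_corners s"

definition unicellular :: "'a pre_blossoming_map \<Rightarrow> bool" where
  "unicellular s \<longleftrightarrow> card (faces s) = 1"

text \<open>Euler characteristic, genus and orientability of the underlying surface; stems are dangling
  and hence not counted as edges.\<close>

definition euler_characteristic :: "'a pre_blossoming_map \<Rightarrow> int" where
  "euler_characteristic s = int (card (vertices s)) - int (card (edges s)) + int (card (faces s))"

definition genus :: "'a pre_blossoming_map \<Rightarrow> rat" where
  "genus s = (2 - of_int (euler_characteristic s)) / 2"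

text \<open>The set \<open>P\<close> is a choice of a rotation direction for every corner that is consistent around the
  vertices and along the edges.\<close>

definition orientable :: "'a pre_blossoming_map \<Rightarrow> bool" where
  "orientable s \<longleftrightarrow>
     (\<exists>P\<subseteq>corners s. (\<forall>c\<in>corners s. c \<in> P \<longleftrightarrow> rev_corner s c \<notin> P) \<and>
        (\<forall>c\<in>P. sig s c \<in> P \<and> theta s c \<in> P))"


section \<open>The tour\<close>

text \<open>In a unicellular map, the tour visits exactly one of the two orientations of each corner, so
  that its length is half the number of oriented corners.\<close>

definition tour :: "'a pre_blossoming_map \<Rightarrow> 'a list" where
  "tour s = map (\<lambda>k. (theta s ^^ k) (root_corner s)) [1..<Suc (card (corners s) div 2)]"

text \<open>The rank of an unoriented corner in the visiting order: \<open>\<theta>(\<rho>)\<close> is first and \<open>\<rho>\<close> is last.\<close>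

definition visit_time :: "'a pre_blossoming_map \<Rightarrow> 'a \<Rightarrow> nat" where
  "visit_time s c =
     (LEAST k. k \<ge> 1 \<and> (theta s ^^ k) (root_corner s) \<in> {c, rev_corner s c})"

text \<open>The sequence of edges in the order in which the tour traverses them (each edge occurs twice);
  the crossings of stems are skipped. Edges that follow each other in this list are consecutive in
  the tour.\<close>

definition tour_edges :: "'a pre_blossoming_map \<Rightarrow> 'a set list" where
  "tour_edges s = map (edge_of s) (filter (\<lambda>c. c \<in> edge_corners s) (tour s))"

text \<open>When the tour is at \<open>c\<close>, it next traverses the edge following \<open>c\<close> starting from the end at which
  \<open>c\<close> lies. An edge is forward if its two traversals, one along each of its sides, start at the
  same end.\<close>

definition forward_edge :: "'a pre_blossoming_map \<Rightarrow> 'a set \<Rightarrow> bool" where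
  "forward_edge s e \<longleftrightarrow>
     (\<exists>c\<in>edge_corners s. e = edge_of s c \<and> c \<in> set (tour s) \<and> other_side s c \<in> set (tour s))"


section \<open>Decent labelings and schemes\<close>

text \<open>A labeling of the corners is a labeling of the oriented corners that is invariant under
  \<open>rev_corner\<close>.\<close>

definition decent_labeling :: "'a pre_blossoming_map \<Rightarrow> ('a \<Rightarrow> int) \<Rightarrow> bool" where
  "decent_labeling s l \<longleftrightarrow>
     (\<forall>c\<in>corners s. l (rev_corner s c) = l c) \<and>
     l (root_corner s) = 0 \<and>
     (\<forall>c\<in>buds s. c \<in> set (tour s) \<longrightarrow> l (sig s c) = l c + 1) \<and>
     (\<forall>c\<in>leaves s. c \<in> set (tour s) \<longrightarrow> l (sig s c) = l c - 1) \<and>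
     (\<forall>c\<in>edge_corners s.
        if visit_time s c < visit_time s (sig s c) then l (sig s c) = l c - 1
        else l c = l (sig s c) - 1)"

definition interior_degree :: "'a pre_blossoming_map \<Rightarrow> 'a set \<Rightarrow> nat" where
  "interior_degree s v = card (halfedge_of s ` (v \<inter> edge_corners s))"

text \<open>The halfedge preceding the root corner is the one following its reverse.\<close>

definition virtual_buds :: "'a pre_blossoming_map \<Rightarrow> 'a set set" where
  "virtual_buds s = (if virtually_rooted s
     then {halfedge_of s (root_corner s), halfedge_of s (rev_corner s (root_corner s))} else {})"

definition vertex_degree :: "'a pre_blossoming_map \<Rightarrow> 'a set \<Rightarrow> nat" where
  "vertex_degree s v = card (halfedge_of s ` v - virtual_buds s)"

definition four_valent :: "'a pre_blossoming_map \<Rightarrow> bool" where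
  "four_valent s \<longleftrightarrow> (\<forall>v\<in>vertices s. vertex_degree s v = 4)"

definition scheme_map :: "'a pre_blossoming_map \<Rightarrow> bool" where
  "scheme_map s \<longleftrightarrow>
     blossoming_map s \<and> unicellular s \<and> (\<forall>v\<in>vertices s. interior_degree s v \<ge> 3) \<and>
     root_corner s \<in> buds s \<and>
     (virtually_rooted s \<longrightarrow>
        rev_corner s (root_corner s) \<in> buds s \<and>
        sig s (root_corner s) \<notin> buds s \<and>
        sig s (rev_corner s (root_corner s)) \<notin> buds s)"

definition labeled_scheme :: "'a pre_blossoming_map \<Rightarrow> ('a \<Rightarrow> int) \<Rightarrow> bool" where
  "labeled_scheme s l \<longleftrightarrow> scheme_map s \<and> decent_labeling s l"

definition unlabeled_scheme :: "'a pre_blossoming_map \<Rightarrow> bool" where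
  "unlabeled_scheme s \<longleftrightarrow> (\<exists>l. labeled_scheme s l)"


section \<open>The offset graph\<close>

text \<open>The relative labeling, and hence all the notions below, do not depend on the choice of the
  decent labeling \<open>l\<close> of a given unlabeled scheme.\<close>

definition relative_label :: "'a pre_blossoming_map \<Rightarrow> ('a \<Rightarrow> int) \<Rightarrow> 'a \<Rightarrow> int" where
  "relative_label s l c = l c - Min (l ` vertex_of s c)"

text \<open>Relative type of the halfedge following \<open>c\<close>.\<close>

definition relative_type :: "'a pre_blossoming_map \<Rightarrow> ('a \<Rightarrow> int) \<Rightarrow> 'a \<Rightarrow> int" where
  "relative_type s l c = min (relative_label s l c) (relative_label s l (sig s c))"

text \<open>The edge \<open>e\<close> with endpoints \<open>u\<close> and \<open>v\<close> is offset toward \<open>v\<close>.\<close>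

definition offset_toward ::
  "'a pre_blossoming_map \<Rightarrow> ('a \<Rightarrow> int) \<Rightarrow> 'a set \<Rightarrow> 'a set \<Rightarrow> 'a set \<Rightarrow> bool" where
  "offset_toward s l e u v \<longleftrightarrow>
     (\<exists>c\<in>edge_corners s. e = edge_of s c \<and> u = vertex_of s c \<and> v = vertex_of s (opp s c) \<and>
        relative_type s l c = 0 \<and> relative_type s l (opp s c) = 1)"

text \<open>The two halfedges of an offset edge have different relative types, so its two endpoints below
  are uniquely determined.\<close>

definition offset_graph ::
  "'a pre_blossoming_map \<Rightarrow> ('a \<Rightarrow> int) \<Rightarrow> ('a set, 'a set) pre_digraph" where
  "offset_graph s l =
     \<lparr>verts = vertices s,
      arcs = {e. \<exists>u v. offset_toward s l e u v},
      tail = (\<lambda>e. THE u. \<exists>v. offset_toward s l e u v),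
      head = (\<lambda>e. THE v. \<exists>u. offset_toward s l e u v)\<rparr>"

text \<open>An offset cycle is given by the list of its edges in cyclic order, starting from any of its
  vertices; loops are allowed.\<close>

definition offset_cycle :: "'a pre_blossoming_map \<Rightarrow> ('a \<Rightarrow> int) \<Rightarrow> 'a set list \<Rightarrow> bool" where
  "offset_cycle s l p \<longleftrightarrow> pre_digraph.cycle (offset_graph s l) p"

definition cycle_vertices ::
  "'a pre_blossoming_map \<Rightarrow> ('a \<Rightarrow> int) \<Rightarrow> 'a set list \<Rightarrow> 'a set set" where
  "cycle_vertices s l p = tail (offset_graph s l) ` set p"

text \<open>The edges of a cycle are pairwise distinct, and a simple directed cycle is determined, up to the
  choice of its starting vertex, by its set of edges. Each cycle is therefore counted once, with its
  length.\<close>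

definition total_cycle_length :: "'a pre_blossoming_map \<Rightarrow> ('a \<Rightarrow> int) \<Rightarrow> nat" where
  "total_cycle_length s l = (\<Sum>C\<in>{set p |p. offset_cycle s l p}. card C)"

lemma finite_offset_cycles:
  assumes "finite (corners s)"
  shows "finite {set p |p. offset_cycle s l p}"
proof -
  have "{set p |p. offset_cycle s l p} \<subseteq> Pow (edge_of s ` edge_corners s)"
    by (auto simp: offset_cycle_def pre_digraph.cycle_def pre_digraph.awalk_def
        offset_graph_def offset_toward_def)
  moreover have "finite (edge_corners s)"
    using assms by (simp add: edge_corners_def)
  ultimately show ?thesis
    by (meson finite_Pow_iff finite_imageI finite_subset)
qed

end

theory Submission
  imports Defs
begin

text \<open>The labels record the order of the visits. At the halfedges of edges, at leaves and
  at the root bud, the corner with the smaller label is visited later; at any other bud it is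
  visited just before the corner with the larger label (\<open>drop_cases\<close>).

  Let an edge be offset from \<open>u\<close> toward \<open>v\<close>. Its two sides are visited
  in the same order at both ends (\<open>side_order\<close>). The earlier side therefore joins a
  corner of relative label 1 at \<open>u\<close> and a corner of relative label 2 at
  \<open>v\<close>, and the later side joins labels 0 and 1, the visits of the two ends of a side
  being one unit of time apart. When an offset cycle goes through a vertex, let \<open>m\<close>
  be the time of the corner with label 2 at the incoming edge and \<open>M\<close> the time of the
  corner with label 0 at the outgoing edge. If \<open>m\<close> precedes the corner with label 1
  at the outgoing edge, then \<open>m\<close> increases from this vertex to the next, strictly if
  these are distinct, and similarly for \<open>M\<close>; this can only go on around the whole
  cycle if it is a loop. A bud can make \<open>m\<close> drop, or \<open>M\<close>, but no vertex
  does both (\<open>passage_cases\<close>). The drop is by exactly 2 and the skipped time belongs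
  to the vertex with the bud. By counting, \<open>m\<close> must drop at all vertices but one
  (\<open>cyclic_descent\<close>), and \<open>M\<close> must drop somewhere as well, so that a
  cycle that is not a loop has exactly two vertices, one for each kind of drop
  (\<open>cyclic_offset_flags\<close>). The direction of the tour at the two buds then shows that
  the tour traverses the two edges in a row, twice, and both times in the same direction. On an
  orientable surface no edge is forward, so there are no offset cycles.

  In every offset cycle the incoming edge is entered by the tour from the corner with label 2 and
  the outgoing edge is left at the corner with label 0. Both corners are unique at an ordinary
  vertex and one of them is at a virtual root vertex, so a vertex determines the cycle through it (\<open>passage_unique\<close>,
  \<open>offset_cycles_disjoint\<close>).

  In a unicellular map, twice the genus is the number of edges outside a spanning tree. Hence the
  bound on the total length follows once the graph is known to stay connected when all edges of
  offset cycles are deleted. To see this, follow the tour and omit these edges. A loop can be skipped, and when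
  the tour passes through a cycle of length 2 it returns immediately to the vertex from which it
  came, so that the pass can be cut out (\<open>tour_connected\<close>). The vertex lost in this
  way is visited by the tour at other times (\<open>all_vertices_connected\<close>).\<close>

section \<open>Reflections of a cyclic order\<close>

text \<open>The tour runs through one orientation of each corner, and so does the rotation around
  a vertex. Both facts rest on the same remark: \<open>r\<close> reverses the direction of
  \<open>f\<close>, so that it would act as a reflection on a cyclic orbit that it preserves, and
  would fix an element or swap two successive ones; both are excluded. The induction moves
  \<open>x\<close> and \<open>r x\<close> towards each other, by one application of
  \<open>f\<close> at either end.\<close>

lemma reflected_orbit_disjoint:
  assumes f: "\<And>x. x \<in> A \<Longrightarrow> f x \<in> A" and r: "\<And>x. x \<in> A \<Longrightarrow> r x \<in> A \<and> r (r x) = x \<and> r x \<noteq> x"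
    and rf: "\<And>x. x \<in> A \<Longrightarrow> r (f (r (f x))) = x \<and> r (f x) \<noteq> x"
    and x: "x \<in> A"
  shows "(f ^^ k) x \<noteq> r x"
  using x
proof (induction k arbitrary: x rule: less_induct)
  case (less k)
  have inj: "y = z" if "y \<in> A" "z \<in> A" "f y = f z" for y z
    using rf that by metis
  have iter: "(f ^^ j) y \<in> A" if "y \<in> A" for j y
    using that f by (induction j) auto
  consider "k = 0" | "k = 1" | j where "k = Suc (Suc j)"
    by (metis One_nat_def not0_implies_Suc)
  then show ?case
  proof cases
    case 1
    then show ?thesis using r[OF less.prems] by auto
  next
    case 2
    then show ?thesis using rf[OF less.prems] r[OF less.prems] by auto
  next
    case 3
    show ?thesis
    proof
      assume eq: "(f ^^ k) x = r x"
      have "f (r (f x)) = r x"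
        using rf[OF less.prems] r f less.prems by metis
      moreover have "(f ^^ k) x = f ((f ^^ j) (f x))"
        using 3 by (simp add: funpow_swap1)
      ultimately have "f ((f ^^ j) (f x)) = f (r (f x))"
        using eq by simp
      then have "(f ^^ j) (f x) = r (f x)"
        using inj iter f r less.prems by meson
      then show False
        using less.IH[of j "f x"] 3 f less.prems by simp
    qed
  qed
qed

lemma finite_orbit_period:
  assumes fin: "finite A" and f: "\<And>x. x \<in> A \<Longrightarrow> f x \<in> A" and inj: "inj_on f A" and x: "x \<in> A"
  obtains N where "N > 0" "(f ^^ N) x = x" "inj_on (\<lambda>i. (f ^^ i) x) {..<N}"
proof -
  have iter: "(f ^^ j) x \<in> A" for j
    using x f by (induction j) auto
  have cancel: "(f ^^ j) x = x" if "(f ^^ (i + j)) x = (f ^^ i) x" for i j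
    using that
  proof (induction i)
    case (Suc i)
    then have "f ((f ^^ (i + j)) x) = f ((f ^^ i) x)" by simp
    then have "(f ^^ (i + j)) x = (f ^^ i) x"
      using inj iter by (meson inj_onD)
    then show ?case by (rule Suc.IH)
  qed simp
  have "\<not> inj (\<lambda>i. (f ^^ i) x)"
    using fin iter by (metis finite_subset image_subsetI infinite_UNIV_nat finite_imageD)
  then obtain i j where "i < j" "(f ^^ i) x = (f ^^ j) x"
    unfolding inj_def by (metis linorder_neqE_nat)
  then have "j - i > 0 \<and> (f ^^ (j - i)) x = x"
    using cancel[of i "j - i"] by simp
  then have ex: "\<exists>N>0. (f ^^ N) x = x" by blast
  define N where "N = (LEAST N. N > 0 \<and> (f ^^ N) x = x)"
  have N: "N > 0 \<and> (f ^^ N) x = x"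
    unfolding N_def using ex by (rule LeastI_ex)
  have least: "N \<le> m" if "m > 0" "(f ^^ m) x = x" for m
    unfolding N_def using that by (intro Least_le) simp
  have "inj_on (\<lambda>i. (f ^^ i) x) {..<N}"
  proof (rule linorder_inj_onI)
    fix i j assume ij: "i < j" "i \<in> {..<N}" "j \<in> {..<N}"
    show "(f ^^ i) x \<noteq> (f ^^ j) x"
    proof
      assume "(f ^^ i) x = (f ^^ j) x"
      then have "(f ^^ (j - i)) x = x"
        using cancel[of i "j - i"] ij by simp
      then show False using least[of "j - i"] ij by simp
    qed
  qed auto
  with N show ?thesis using that by blast
qed

section \<open>The tour of a unicellular map\<close>

locale unicellular_map =
  fixes s :: "'a pre_blossoming_map"
  assumes map: "blossoming_map s" and unicellular: "unicellular s"
    and root_bud: "root_corner s \<in> buds s"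
begin

abbreviation "C \<equiv> corners s"
abbreviation "E \<equiv> edge_corners s"
abbreviation "T \<equiv> set (tour s)"
abbreviation "rv \<equiv> rev_corner s"
abbreviation "\<sigma> \<equiv> sig s"
abbreviation "os \<equiv> other_side s"
abbreviation "mate \<equiv> opp s"
abbreviation "\<rho> \<equiv> root_corner s"
abbreviation "vt \<equiv> visit_time s"
abbreviation "vx \<equiv> vertex_of s"

definition tour_len :: nat where "tour_len = card C div 2"
definition tour_at :: "nat \<Rightarrow> 'a" where "tour_at k = (theta s ^^ k) \<rho>"

lemma finite_C: "finite C" and root_C [simp]: "\<rho> \<in> C"
  using map by (auto simp: blossoming_map_def)

lemma rv_C [simp]: "c \<in> C \<Longrightarrow> rv c \<in> C" and rv_rv [simp]: "c \<in> C \<Longrightarrow> rv (rv c) = c"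
  and rv_neq [simp]: "c \<in> C \<Longrightarrow> rv c \<noteq> c"
  using map by (auto simp: blossoming_map_def)

lemma sg_C [simp]: "c \<in> C \<Longrightarrow> \<sigma> c \<in> C" and os_os [simp]: "c \<in> C \<Longrightarrow> os (os c) = c"
  and os_neq [simp]: "c \<in> C \<Longrightarrow> os c \<noteq> c"
  using map by (auto simp: blossoming_map_def)

lemma os_C [simp]: "c \<in> C \<Longrightarrow> os c \<in> C"
  by (simp add: other_side_def)

lemma rv_os [simp]: "c \<in> C \<Longrightarrow> rv (os c) = \<sigma> c"
  by (simp add: other_side_def)

lemma sg_os [simp]: "c \<in> C \<Longrightarrow> \<sigma> (os c) = rv c"
  by (metis os_C os_os rv_C rv_os rv_rv)

lemma sg_rv_sg [simp]: "c \<in> C \<Longrightarrow> \<sigma> (rv (\<sigma> c)) = rv c"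
  using sg_os by (simp add: other_side_def)

lemma os_buds [simp]: "c \<in> C \<Longrightarrow> os c \<in> buds s \<longleftrightarrow> c \<in> buds s"
  using map os_os unfolding blossoming_map_def by metis

lemma os_leaves [simp]: "c \<in> C \<Longrightarrow> os c \<in> leaves s \<longleftrightarrow> c \<in> leaves s"
  using map os_os unfolding blossoming_map_def by metis

lemma buds_leaves: "c \<in> buds s \<Longrightarrow> c \<notin> leaves s"
  using map unfolding blossoming_map_def by blast

lemma E_C [simp]: "c \<in> E \<Longrightarrow> c \<in> C" 
  by (simp add: edge_corners_def)

lemma E_iff: "c \<in> C \<Longrightarrow> c \<in> E \<longleftrightarrow> c \<notin> buds s \<and> c \<notin> leaves s"
  by (simp add: edge_corners_def)

lemma os_E [simp]: "c \<in> C \<Longrightarrow> os c \<in> E \<longleftrightarrow> c \<in> E"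
  by (simp add: E_iff)

lemma mate_E [simp]: "c \<in> E \<Longrightarrow> mate c \<in> E" and mate_mate [simp]: "c \<in> E \<Longrightarrow> mate (mate c) = c"
  and mate_neq [simp]: "c \<in> E \<Longrightarrow> mate c \<noteq> c"
  and mate_os: "c \<in> E \<Longrightarrow> mate (os c) = os (mate c)"
  and mate_neq_os [simp]: "c \<in> E \<Longrightarrow> mate c \<noteq> os c"
  using map by (auto simp: blossoming_map_def)

lemma root_notin_E [simp]: "\<rho> \<notin> E"
  using root_bud by (simp add: edge_corners_def)

lemma theta_E: "c \<in> E \<Longrightarrow> theta s c = rv (mate c)"
  by (simp add: theta_def)

lemma theta_stem: "c \<notin> E \<Longrightarrow> theta s c = \<sigma> c"
  by (simp add: theta_def)

lemma theta_C [simp]: "c \<in> C \<Longrightarrow> theta s c \<in> C"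
  by (simp add: theta_def)

lemma rv_theta_rv_theta: "c \<in> C \<Longrightarrow> rv (theta s (rv (theta s c))) = c"
proof (cases "c \<in> E")
  case False
  assume c: "c \<in> C"
  moreover from False c have "os c \<notin> E" by simp
  ultimately show ?thesis using False by (simp add: theta_stem other_side_def[symmetric])
qed (simp add: theta_E)

lemma rv_theta_neq: "c \<in> C \<Longrightarrow> rv (theta s c) \<noteq> c"
proof (cases "c \<in> E")
  case False
  assume c: "c \<in> C"
  then show ?thesis using False os_neq[OF c] by (simp add: theta_stem other_side_def)
qed (simp add: theta_E)

lemma theta_rv_theta: "c \<in> C \<Longrightarrow> theta s (rv (theta s c)) = rv c"
  by (metis rv_C rv_rv rv_theta_rv_theta theta_C)

lemma inj_theta: "inj_on (theta s) C"
  by (rule inj_onI) (metis rv_theta_rv_theta)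

lemma tour_at_C [simp]: "tour_at k \<in> C"
  unfolding tour_at_def by (induction k) auto

lemma tour_at_Suc: "tour_at (Suc k) = theta s (tour_at k)"
  by (simp add: tour_at_def)

text \<open>An edge side never leads from a corner to the opposite orientation of the same corner,
  which is what keeps the tour disjoint from its reversal.\<close>

lemma rv_tour_at_neq: "rv (tour_at i) \<noteq> tour_at j"
proof -
  have *: "(theta s ^^ k) c \<noteq> rv c" if "c \<in> C" for k c
    by (rule reflected_orbit_disjoint[where A = C]) (use that rv_theta_neq rv_theta_rv_theta in auto)
  have step: "(theta s ^^ k) (tour_at i) = tour_at (i + k)" for i k
    by (simp add: tour_at_def funpow_add add.commute[of i])
  show ?thesis
  proof (cases "i \<le> j")
    case True
    then show ?thesis using *[of "tour_at i" "j - i"] step[of "j - i" i] by auto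
  next
    case False
    then have "tour_at i \<noteq> rv (tour_at j)" using *[of "tour_at j" "i - j"] step[of "i - j" j] by auto
    then show ?thesis by (metis rv_rv tour_at_C)
  qed
qed

lemma tour_period_exists:
  obtains N where "N > 0" "tour_at N = \<rho>" "inj_on tour_at {..<N}" "\<forall>k. tour_at (k mod N) = tour_at k"
proof -
  obtain N where N: "N > 0" "(theta s ^^ N) \<rho> = \<rho>" "inj_on (\<lambda>i. (theta s ^^ i) \<rho>) {..<N}"
    by (rule finite_orbit_period[of C "theta s" \<rho>]) (auto simp: finite_C inj_theta)
  then have "tour_at (k mod N) = tour_at k" for k
    unfolding tour_at_def by (intro funpow_mod_eq) simp
  moreover have "inj_on tour_at {..<N}" "tour_at N = \<rho>"
    using N by (simp_all add: tour_at_def[abs_def])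
  ultimately show ?thesis using that N(1) by blast
qed

text \<open>Unicellularity enters here: the single face consists of the tour and its reversal.\<close>

lemma all_corners: "C = range tour_at \<union> rv ` range tour_at"
proof
  let ?R = "{(x, rv x) |x. x \<in> C} \<union> {(x, theta s x) |x. x \<in> C}"
  let ?O = "range tour_at \<union> rv ` range tour_at"
  obtain N where N: "N > 0" "tour_at N = \<rho>"
    by (rule tour_period_exists)
  have pred: "theta s (rv (tour_at k)) \<in> ?O" for k
  proof -
    have "\<exists>i. tour_at k = tour_at (Suc i)"
    proof (cases k)
      case 0
      then have "tour_at k = tour_at (Suc (N - 1))"
        using N by (simp add: tour_at_def)
      then show ?thesis by blast
    qed auto
    then obtain i where "tour_at k = theta s (tour_at i)" by (auto simp: tour_at_Suc)
    then have "theta s (rv (tour_at k)) = rv (tour_at i)" by (simp add: theta_rv_theta)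
    then show ?thesis by auto
  qed
  show "C \<subseteq> ?O"
  proof
    fix c assume c: "c \<in> C"
    have "face_of s c = face_of s \<rho>"
      using unicellular c unfolding unicellular_def faces_def
      by (metis card_1_singletonE imageI root_C singletonD)
    moreover have "c \<in> face_of s c" by (simp add: face_of_def)
    ultimately have "(\<rho>, c) \<in> ?R\<^sup>*" by (simp add: face_of_def)
    then show "c \<in> ?O"
    proof induction
      case base
      have "\<rho> = tour_at 0" by (simp add: tour_at_def)
      then show ?case by blast
    next
      case (step y z)
      consider "z = rv y" | "z = theta s y" using step by blast
      then show ?case
      proof cases
        case 1
        then show ?thesis using step by force
      next
        case 2
        from step.IH consider k where "y = tour_at k" | k where "y = rv (tour_at k)" by blast
        then show ?thesis
        proof cases
          case 1
          then have "z = tour_at (Suc k)" using 2 by (simp add: tour_at_Suc)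
          then show ?thesis by blast
        next
          case (2 k)
          then show ?thesis using pred[of k] \<open>z = theta s y\<close> by simp
        qed
      qed
    qed
  qed
qed auto

lemma tour_period: "tour_len > 0" "tour_at tour_len = \<rho>" "inj_on tour_at {..<tour_len}" "tour_at (k mod tour_len) = tour_at k"
proof -
  obtain N where N: "N > 0" "tour_at N = \<rho>" "inj_on tour_at {..<N}" "\<forall>k. tour_at (k mod N) = tour_at k"
    by (rule tour_period_exists)
  have range: "range tour_at = tour_at ` {..<N}"
  proof -
    have "tour_at k \<in> tour_at ` {..<N}" for k
      using N(1,4) by (metis image_eqI lessThan_iff mod_less_divisor)
    then show ?thesis by auto
  qed
  have fin: "finite (range tour_at)" by (simp add: range)
  have "inj_on rv (range tour_at)"
    by (rule inj_onI) (metis rangeE rv_rv tour_at_C)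
  then have image: "card (rv ` range tour_at) = card (range tour_at)" by (rule card_image)
  have "range tour_at \<inter> rv ` range tour_at = {}"
    using rv_tour_at_neq by (auto simp: eq_commute)
  then have "card C = card (range tour_at) + card (rv ` range tour_at)"
    using fin by (subst all_corners) (simp add: card_Un_disjoint)
  also note image
  also have "card (range tour_at) = N"
    using N(3) by (simp add: range card_image)
  finally have "tour_len = N" by (simp add: tour_len_def)
  with N show "tour_len > 0" "tour_at tour_len = \<rho>" "inj_on tour_at {..<tour_len}" "tour_at (k mod tour_len) = tour_at k" by auto
qed

lemma tour_at_inj: "tour_at i = tour_at j \<Longrightarrow> 1 \<le> i \<Longrightarrow> i \<le> tour_len \<Longrightarrow> 1 \<le> j \<Longrightarrow> j \<le> tour_len \<Longrightarrow> i = j"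
proof -
  assume eq: "tour_at i = tour_at j" and b: "1 \<le> i" "i \<le> tour_len" "1 \<le> j" "j \<le> tour_len"
  then have "tour_at (i mod tour_len) = tour_at (j mod tour_len)" by (simp add: tour_period(4))
  then have "i mod tour_len = j mod tour_len"
    using tour_period(1,3) by (simp add: inj_on_def)
  then show "i = j" using b by (cases "i = tour_len"; cases "j = tour_len") auto
qed

lemma tour_set: "T = tour_at ` {1..tour_len}"
  by (auto simp: tour_def tour_at_def tour_len_def)

lemma tour_range: "T = range tour_at"
proof -
  have "tour_at k \<in> T" for k
  proof (cases "k mod tour_len = 0")
    case True
    then have "tour_at k = tour_at tour_len" using tour_period by (metis mod_self)
    then show ?thesis using tour_period(1) by (auto simp: tour_set)
  next
    case False
    moreover have "k mod tour_len < tour_len" using tour_period(1) by simp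
    ultimately have "tour_at (k mod tour_len) \<in> T" by (auto simp: tour_set)
    then show ?thesis by (simp add: tour_period(4))
  qed
  then show ?thesis by (auto simp: tour_set)
qed

lemma tour_C: "c \<in> T \<Longrightarrow> c \<in> C"
  by (auto simp: tour_range)

lemma root_T [simp]: "\<rho> \<in> T"
  using tour_period by (metis rangeI tour_range)

lemma rv_T [simp]: "c \<in> C \<Longrightarrow> rv c \<in> T \<longleftrightarrow> c \<notin> T"
  using all_corners rv_tour_at_neq by (auto simp: tour_range)

lemma theta_T [simp]: assumes "c \<in> C" shows "theta s c \<in> T \<longleftrightarrow> c \<in> T"
proof -
  have fwd: "theta s x \<in> T" if "x \<in> T" for x
    using that by (auto simp: tour_range) (metis rangeI tour_at_Suc)
  moreover have "c \<in> T" if "theta s c \<in> T"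
  proof -
    have "theta s c \<in> range tour_at" using that by (simp add: tour_range)
    then obtain k where "theta s c = tour_at k" by blast
    also have "\<dots> = tour_at (Suc (k + tour_len - 1))"
      using tour_period(1) tour_period(4)[of k] tour_period(4)[of "k + tour_len"] by simp
    finally have "c = tour_at (k + tour_len - 1)"
      using inj_theta assms by (simp add: tour_at_Suc inj_on_eq_iff)
    then show ?thesis by (simp add: tour_range)
  qed
  ultimately show ?thesis by blast
qed

lemma vt_tour_at: assumes "1 \<le> k" "k \<le> tour_len" shows "vt (tour_at k) = k"
  unfolding visit_time_def
proof (rule Least_equality)
  show "k \<ge> 1 \<and> (theta s ^^ k) \<rho> \<in> {tour_at k, rv (tour_at k)}" using assms by (simp add: tour_at_def)
next
  fix j assume "j \<ge> 1 \<and> (theta s ^^ j) \<rho> \<in> {tour_at k, rv (tour_at k)}"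
  then have "j \<ge> 1" "tour_at j = tour_at k"
    using rv_tour_at_neq[of k j] by (auto simp: tour_at_def[symmetric])
  then show "k \<le> j" using tour_at_inj[of j k] assms by (cases "j \<le> tour_len") auto
qed

lemma vt_rv [simp]: "c \<in> C \<Longrightarrow> vt (rv c) = vt c"
  by (simp add: visit_time_def insert_commute)

lemma vt_T: assumes "c \<in> T" shows "1 \<le> vt c" "vt c \<le> tour_len" "tour_at (vt c) = c"
  using assms vt_tour_at by (auto simp: tour_set)

lemma vt_bounds: assumes "c \<in> C" shows "1 \<le> vt c" "vt c \<le> tour_len"
  using vt_T(1,2)[of c] vt_T(1,2)[of "rv c"] assms by auto

lemma vt_root [simp]: "vt \<rho> = tour_len"
  using vt_tour_at[of tour_len] tour_period by simp

lemma vt_inj_T: "c \<in> T \<Longrightarrow> d \<in> T \<Longrightarrow> vt c = vt d \<Longrightarrow> c = d"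
  by (metis vt_T(3))

lemma vt_eq_iff: assumes "c \<in> C" "d \<in> C" shows "vt c = vt d \<longleftrightarrow> d = c \<or> d = rv c"
proof -
  have "\<exists>e \<in> T. e = d \<or> e = rv d" "\<exists>e \<in> T. e = c \<or> e = rv c"
    using assms rv_T by blast+
  then obtain e e' where "e \<in> T" "e = d \<or> e = rv d" "e' \<in> T" "e' = c \<or> e' = rv c" by blast
  moreover from this have "vt e = vt d" "vt e' = vt c" using assms by auto
  ultimately show ?thesis using assms vt_inj_T[of e e'] by (metis rv_rv vt_rv)
qed

lemma vt_eq_n: "c \<in> T \<Longrightarrow> vt c = tour_len \<longleftrightarrow> c = \<rho>"
  using vt_inj_T[of c \<rho>] by auto

lemma vt_theta: assumes "c \<in> T" "c \<noteq> \<rho>" shows "vt (theta s c) = vt c + 1"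
proof -
  have "vt c < tour_len" using vt_T(2)[OF assms(1)] vt_eq_n assms by fastforce
  moreover have "theta s c = tour_at (Suc (vt c))" using assms vt_T by (simp add: tour_at_Suc)
  ultimately show ?thesis using vt_tour_at[of "Suc (vt c)"] by simp
qed

lemma vt_sg_root [simp]: "vt (\<sigma> \<rho>) = 1"
proof -
  have "tour_at 1 = \<sigma> \<rho>" by (simp add: tour_at_def theta_stem)
  then show ?thesis using vt_tour_at[of 1] tour_period(1) by simp
qed

lemma sg_root_T [simp]: "\<sigma> \<rho> \<in> T"
  using theta_T[OF root_C] by (simp add: theta_stem)

lemma mate_T: assumes "c \<in> E" shows "mate c \<in> T \<longleftrightarrow> c \<notin> T"
  using theta_T[of c] assms by (simp add: theta_E) blast

lemma os_T_stem: assumes "c \<in> C" "c \<notin> E" shows "os c \<in> T \<longleftrightarrow> c \<notin> T"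
  using theta_T[of c] assms by (simp add: theta_stem other_side_def)

text \<open>A side of an edge takes one unit of time, and the last corner is never followed by an
  edge, so that there is no jump from the end of the tour to its beginning.\<close>

lemma vt_mate: "c \<in> E \<Longrightarrow> c \<in> T \<Longrightarrow> vt (mate c) = vt c + 1"
  using vt_theta[of c] by (cases "c = \<rho>") (simp_all add: theta_E)

lemma vt_mate': "c \<in> E \<Longrightarrow> c \<notin> T \<Longrightarrow> vt c = vt (mate c) + 1"
  using vt_mate[of "mate c"] by (simp add: mate_T)

lemma vx_iff_rtrancl: "d \<in> vx c \<longleftrightarrow> (c, d) \<in> ({(x, rv x) |x. x \<in> C} \<union> {(x, \<sigma> x) |x. x \<in> C})\<^sup>*"
  by (simp add: vertex_of_def)

lemma vx_C: "d \<in> vx c \<Longrightarrow> c \<in> C \<Longrightarrow> d \<in> C"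
  unfolding vx_iff_rtrancl by (induction rule: rtrancl_induct) auto

lemma vx_refl [simp]: "c \<in> vx c"
  by (simp add: vx_iff_rtrancl)

lemma sym_vx: "sym (({(x, rv x) |x. x \<in> C} \<union> {(x, \<sigma> x) |x. x \<in> C})\<^sup>*)" (is "sym (?R\<^sup>*)")
proof -
  have "(z, y) \<in> ?R\<^sup>*" if "(y, z) \<in> ?R" for y z
  proof (cases "z = rv y")
    case True
    then have "y \<in> C" using that by auto
    then have "(rv y, rv (rv y)) \<in> ?R" by (blast intro: rv_C)
    then show ?thesis using True \<open>y \<in> C\<close> by auto
  next
    case False
    then have z: "z = \<sigma> y" "y \<in> C" using that by auto
    have "(\<sigma> y, rv (\<sigma> y)) \<in> ?R" "(rv (\<sigma> y), \<sigma> (rv (\<sigma> y))) \<in> ?R" "(rv y, rv (rv y)) \<in> ?R"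
      using z by (blast intro: sg_C rv_C)+
    then show ?thesis using z
      by (metis (no_types, lifting) r_into_rtrancl rtrancl_trans rv_rv sg_rv_sg)
  qed
  then have "?R\<inverse> \<subseteq> ?R\<^sup>*" by (auto simp del: rv_C)
  then have "(?R\<inverse>)\<^sup>* \<subseteq> ?R\<^sup>*" by (rule rtrancl_subset_rtrancl)
  moreover have "(y, x) \<in> (?R\<inverse>)\<^sup>*" if "(x, y) \<in> ?R\<^sup>*" for x y
    using that by (rule rtrancl_converseI)
  ultimately show ?thesis by (intro symI) blast
qed

lemma vx_eq: "d \<in> vx c \<Longrightarrow> vx d = vx c"
  using sym_vx unfolding vertex_of_def
  by (auto intro: rtrancl_trans dest: symD)

lemma vx_rv [simp]: "c \<in> C \<Longrightarrow> vx (rv c) = vx c"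
  by (rule vx_eq) (auto simp: vx_iff_rtrancl intro: r_into_rtrancl)

lemma vx_sg [simp]: "c \<in> C \<Longrightarrow> vx (\<sigma> c) = vx c"
  by (rule vx_eq) (auto simp: vx_iff_rtrancl intro: r_into_rtrancl)

lemma vx_os [simp]: "c \<in> C \<Longrightarrow> vx (os c) = vx c"
  by (simp add: other_side_def)

lemma vx_theta_stem: "c \<in> C \<Longrightarrow> c \<notin> E \<Longrightarrow> vx (theta s c) = vx c"
  by (simp add: theta_stem)

lemma vx_theta_edge: "c \<in> E \<Longrightarrow> vx (theta s c) = vx (mate c)"
  by (simp add: theta_E)

end

section \<open>Decent labelings\<close>

locale decent_map = unicellular_map +
  fixes l :: "'a \<Rightarrow> int"
  assumes decent: "decent_labeling s l"
begin

lemma l_rv [simp]: "c \<in> C \<Longrightarrow> l (rv c) = l c"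
  using decent by (simp add: decent_labeling_def)

lemma l_os [simp]: "c \<in> C \<Longrightarrow> l (os c) = l (\<sigma> c)"
  by (simp add: other_side_def)

lemma l_root [simp]: "l \<rho> = 0"
  using decent by (simp add: decent_labeling_def)

lemma l_bud: "c \<in> buds s \<Longrightarrow> c \<in> T \<Longrightarrow> l (\<sigma> c) = l c + 1"
  using decent by (simp add: decent_labeling_def)

lemma l_leaf: "c \<in> leaves s \<Longrightarrow> c \<in> T \<Longrightarrow> l (\<sigma> c) = l c - 1"
  using decent by (simp add: decent_labeling_def)

lemma l_edge: "c \<in> E \<Longrightarrow> if vt c < vt (\<sigma> c) then l c = l (\<sigma> c) + 1 else l (\<sigma> c) = l c + 1"
  using decent by (auto simp: decent_labeling_def)

lemma not_edge_cases:
  assumes "c \<in> C" "c \<notin> E"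
  obtains "c \<in> buds s" | "c \<in> leaves s"
  using assms E_iff by blast

lemma label_step: assumes "c \<in> C" shows "l c = l (\<sigma> c) + 1 \<or> l (\<sigma> c) = l c + 1"
proof (cases "c \<in> E")
  case True
  then show ?thesis using l_edge[of c] by (auto split: if_splits)
next
  case False
  have T: "os c \<in> T \<longleftrightarrow> c \<notin> T" using os_T_stem assms False by blast
  from assms False show ?thesis
  proof (cases rule: not_edge_cases)
    case 1
    then show ?thesis
      using l_bud[of c] l_bud[of "os c"] T assms by (cases "c \<in> T") auto
  next
    case 2
    then show ?thesis
      using l_leaf[of c] l_leaf[of "os c"] T assms by (cases "c \<in> T") auto
  qed
qed

lemma sg_neq [simp]: "c \<in> C \<Longrightarrow> \<sigma> c \<noteq> c"
  using label_step[of c] by auto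

lemma vt_sg_neq: assumes "c \<in> C" shows "vt (\<sigma> c) \<noteq> vt c"
proof
  assume "vt (\<sigma> c) = vt c"
  then have "c = \<sigma> c \<or> c = rv (\<sigma> c)" using assms by (simp add: vt_eq_iff)
  then have "l c = l (\<sigma> c)" using assms by (metis l_rv sg_C)
  then show False using label_step[OF assms] by simp
qed

text \<open>Leaves and the root bud, between the last corner and the first, behave like the halfedges of
  edges: the label drops towards the later corner. Only at the other buds is it the earlier corner
  that has the smaller label, and these two corners are visited one right after the other.\<close>

lemma drop_cases:
  assumes c: "c \<in> C" and drop: "l c = l (\<sigma> c) + 1"
  shows "vt c < vt (\<sigma> c) \<or> (os c \<in> buds s \<and> os c \<in> T \<and> rv c \<in> T \<and> vt c = vt (\<sigma> c) + 1)"
proof (cases "c \<in> E")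
  case True
  then show ?thesis using l_edge[of c] drop by (auto split: if_splits)
next
  case False
  have T: "os c \<in> T \<longleftrightarrow> c \<notin> T" using os_T_stem c False by blast
  have th: "theta s c = \<sigma> c" "theta s (os c) = rv c"
    using c False by (auto simp: theta_stem)
  from c False show ?thesis
  proof (cases rule: not_edge_cases)
    case 1
    then have "c \<notin> T" using l_bud[of c] drop by auto
    with T have os: "os c \<in> T" by simp
    show ?thesis
    \<comment> \<open>The root bud leads from the last corner of the tour back to the first.\<close>
    proof (cases "os c = \<rho>")
      case True
      have "vt (\<sigma> c) = vt (os c)" using c by (simp add: other_side_def)
      then have "vt (\<sigma> c) = tour_len" using True by simp
      then show ?thesis using vt_bounds[OF c] vt_sg_neq[OF c] by simp
    next
      case False
      then have "vt c = vt (\<sigma> c) + 1"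
        using vt_theta[OF os False] th c by (simp add: other_side_def)
      moreover have "rv c \<in> T" using \<open>c \<notin> T\<close> c by simp
      ultimately show ?thesis using os 1 c by simp
    qed
  next
    case 2
    have "c \<in> T"
    proof (rule ccontr)
      assume "c \<notin> T"
      then have "l (\<sigma> (os c)) = l (os c) - 1" using T 2 c by (intro l_leaf) auto
      then show False using drop c by simp
    qed
    moreover have "c \<noteq> \<rho>" using 2 root_bud buds_leaves by blast
    ultimately show ?thesis using vt_theta[of c] th by simp
  qed
qed

lemma drop_edge: "c \<in> E \<Longrightarrow> l c = l (\<sigma> c) + 1 \<Longrightarrow> vt c < vt (\<sigma> c)"
  using l_edge[of c] by (auto split: if_splits)

definition vertex_min :: "'a \<Rightarrow> int" where "vertex_min c = Min (l ` vx c)"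

lemma finite_vx: "c \<in> C \<Longrightarrow> finite (vx c)"
  by (rule finite_subset[OF _ finite_C]) (auto intro: vx_C)

lemma vertex_min_le: "c \<in> C \<Longrightarrow> d \<in> vx c \<Longrightarrow> vertex_min c \<le> l d"
  unfolding vertex_min_def using finite_vx by (intro Min_le) auto

lemma vertex_min_attained: assumes "c \<in> C" obtains d where "d \<in> vx c" "l d = vertex_min c"
proof -
  have "vertex_min c \<in> l ` vx c"
    unfolding vertex_min_def using finite_vx[OF assms] by (intro Min_in) (auto intro: vx_refl)
  then obtain d where "d \<in> vx c" "vertex_min c = l d" by (rule imageE)
  with that show ?thesis by simp
qed

lemma vertex_min_cong: "vx c = vx d \<Longrightarrow> vertex_min c = vertex_min d"
  by (simp add: vertex_min_def)

lemma vt_mate_cases: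
  assumes "c \<in> E"
  shows "c \<in> T \<and> mate c \<notin> T \<and> vt (mate c) = vt c + 1 \<or> c \<notin> T \<and> mate c \<in> T \<and> vt c = vt (mate c) + 1"
  using assms vt_mate vt_mate' mate_T by blast

text \<open>The two sides of an edge can only be visited in opposite orders at its two ends if their
  visits overlap, and then the tour would traverse the same side twice.\<close>

lemma side_order:
  assumes c: "c \<in> E" and less: "vt c < vt (\<sigma> c)"
  shows "vt (mate c) < vt (\<sigma> (mate c))"
proof (rule ccontr)
  have C: "c \<in> C" "mate c \<in> C" using c by auto
  have os: "os c \<in> E" "os (mate c) \<in> E" "vt (os c) = vt (\<sigma> c)" "vt (os (mate c)) = vt (\<sigma> (mate c))"
    using c by (auto simp: other_side_def os_E[unfolded other_side_def])
  assume "\<not> ?thesis"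
  then have gt: "vt (os (mate c)) < vt (mate c)" using os vt_sg_neq[OF C(2)] by simp
  with less os vt_mate_cases[OF c] vt_mate_cases[OF os(1)] c
  have "c \<in> T" "vt (mate c) = vt c + 1" "mate (os c) \<in> T" "vt (os c) = vt (os (mate c)) + 1"
    "vt (os c) = vt c + 1"
    by (auto simp: mate_os)
  then have "vt (mate (os c)) = vt c" using c by (simp add: mate_os)
  then have "mate (os c) = c" using vt_inj_T \<open>c \<in> T\<close> \<open>mate (os c) \<in> T\<close> by blast
  then have "mate c = os c" using os(1) by (metis mate_mate)
  then show False using c by simp
qed

end

section \<open>Vertices\<close>

context unicellular_map
begin

lemma sg_iter_C: "c \<in> C \<Longrightarrow> (\<sigma> ^^ k) c \<in> C"
  by (induction k) auto

lemma sg_eq_imp: "c \<in> C \<Longrightarrow> d \<in> C \<Longrightarrow> \<sigma> c = \<sigma> d \<Longrightarrow> c = d"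
  by (metis os_os other_side_def)

lemma inj_sg: "inj_on \<sigma> C"
  by (rule inj_onI) (rule sg_eq_imp)

lemma rv_sg_iter_neq:
  assumes "c \<in> C" shows "rv ((\<sigma> ^^ i) c) \<noteq> (\<sigma> ^^ j) c"
proof -
  have *: "(\<sigma> ^^ k) c \<noteq> rv c" if "c \<in> C" for k c
    by (rule reflected_orbit_disjoint[where A = C])
       (use that os_neq os_os in \<open>auto simp: other_side_def\<close>)
  have step: "(\<sigma> ^^ k) ((\<sigma> ^^ i) c) = (\<sigma> ^^ (i + k)) c" for i k
    by (simp add: funpow_add add.commute[of i])
  show ?thesis
  proof (cases "i \<le> j")
    case True
    then show ?thesis using *[of "(\<sigma> ^^ i) c" "j - i"] step[of "j - i" i] assms sg_iter_C by auto
  next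
    case False
    then have "(\<sigma> ^^ i) c \<noteq> rv ((\<sigma> ^^ j) c)"
      using *[of "(\<sigma> ^^ j) c" "i - j"] step[of "i - j" j] assms sg_iter_C by auto
    then show ?thesis by (metis rv_rv sg_iter_C assms)
  qed
qed

lemma halfedge_of_os [simp]: "c \<in> C \<Longrightarrow> halfedge_of s (os c) = halfedge_of s c"
  by (auto simp: halfedge_of_def)

lemma halfedge_of_eq_iff: "c \<in> C \<Longrightarrow> d \<in> C \<Longrightarrow> halfedge_of s c = halfedge_of s d \<longleftrightarrow> c = d \<or> c = os d"
  by (auto simp: halfedge_of_def doubleton_eq_iff)

definition turn :: "'a \<Rightarrow> nat \<Rightarrow> 'a" where "turn c i = (\<sigma> ^^ i) c"

lemma turn_simps: "turn c 0 = c" "turn c (Suc i) = \<sigma> (turn c i)"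
  by (simp_all add: turn_def)

lemma turn_C [simp]: "c \<in> C \<Longrightarrow> turn c i \<in> C"
  by (simp add: turn_def sg_iter_C)

lemma rv_turn_neq: "c \<in> C \<Longrightarrow> rv (turn c i) \<noteq> turn c j"
  by (simp add: turn_def rv_sg_iter_neq)

lemma vertex_turns:
  assumes c: "c \<in> C"
  obtains d where "d > 0" "turn c d = c" "inj_on (turn c) {..<d}"
    "vx c = turn c ` {..<d} \<union> rv ` turn c ` {..<d}"
    "halfedge_of s ` vx c = (\<lambda>i. halfedge_of s (turn c i)) ` {..<d}"
    "inj_on (\<lambda>i. halfedge_of s (turn c i)) {..<d}"
proof -
  obtain d where d: "d > 0" "(\<sigma> ^^ d) c = c" "inj_on (\<lambda>i. (\<sigma> ^^ i) c) {..<d}"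
    by (rule finite_orbit_period[of C \<sigma> c]) (auto simp: finite_C inj_sg c)
  have mod: "turn c (k mod d) = turn c k" for k
    unfolding turn_def by (intro funpow_mod_eq d)
  have mem: "turn c k \<in> turn c ` {..<d}" for k
    using d(1) mod[of k] by (metis image_eqI lessThan_iff mod_less_divisor)
  have pred: "\<exists>j. turn c k = \<sigma> (turn c j)" for k
  proof (cases k)
    case 0
    then have "turn c k = \<sigma> (turn c (d - 1))"
      using d(1,2) turn_simps(2)[of c "d - 1"] by (simp add: turn_def)
    then show ?thesis by blast
  qed (auto simp: turn_simps)
  let ?O = "turn c ` {..<d} \<union> rv ` turn c ` {..<d}"
  have "x \<in> ?O" if "x \<in> vx c" for x
    using that unfolding vx_iff_rtrancl
  proof induction
    case base
    show ?case using mem[of 0] by (simp add: turn_simps)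
  next
    case (step y z)
    consider "z = rv y" | "z = \<sigma> y" using step by blast
    then show ?case
    proof cases
      case 1
      then show ?thesis using step.IH c by force
    next
      case 2
      from step.IH consider k where "y = turn c k" | k where "y = rv (turn c k)" by blast
      then show ?thesis
      proof cases
        case (1 k)
        then show ?thesis using 2 mem[of "Suc k"] by (simp add: turn_simps)
      next
        case (2 k)
        then obtain j where "y = rv (\<sigma> (turn c j))" using pred by metis
        then have "z = rv (turn c j)" using \<open>z = \<sigma> y\<close> c by simp
        then show ?thesis using mem[of j] by blast
      qed
    qed
  qed
  moreover have turn_vx: "turn c k \<in> vx c" "rv (turn c k) \<in> vx c" for k
  proof -
    have "vx (turn c k) = vx c" by (induction k) (auto simp: turn_simps c)
    then show "turn c k \<in> vx c" "rv (turn c k) \<in> vx c"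
      using vx_refl[of "turn c k"] vx_refl[of "rv (turn c k)"] c by simp_all
  qed
  ultimately have vx: "vx c = ?O" by blast
  have "halfedge_of s x \<in> (\<lambda>i. halfedge_of s (turn c i)) ` {..<d}" if x: "x \<in> vx c" for x
  proof -
    have "\<exists>j. halfedge_of s x = halfedge_of s (turn c j)"
      using x unfolding vx
    proof
      assume "x \<in> rv ` turn c ` {..<d}"
      then obtain k where "x = rv (turn c k)" by blast
      moreover obtain j where "turn c k = \<sigma> (turn c j)" using pred by blast
      ultimately have "x = rv (\<sigma> (turn c j))" by simp
      then have "x = os (turn c j)" by (simp add: other_side_def)
      then show ?thesis using c by auto
    qed auto
    then obtain j where "halfedge_of s x = halfedge_of s (turn c j)" by blast
    then show ?thesis using mem[of j] by auto
  qed
  then have half: "halfedge_of s ` vx c = (\<lambda>i. halfedge_of s (turn c i)) ` {..<d}"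
    using turn_vx by auto
  have inj: "inj_on (turn c) {..<d}" using d(3) by (simp add: turn_def[abs_def])
  have "inj_on (\<lambda>i. halfedge_of s (turn c i)) {..<d}"
  proof (rule inj_onI)
    fix i j assume ij: "i \<in> {..<d}" "j \<in> {..<d}" "halfedge_of s (turn c i) = halfedge_of s (turn c j)"
    then have "turn c i = turn c j \<or> turn c i = rv (turn c (Suc j))"
      using c by (simp add: halfedge_of_eq_iff turn_simps other_side_def)
    then have "turn c i = turn c j" using rv_turn_neq[OF c] by metis
    then show "i = j" using inj ij by (simp add: inj_on_eq_iff)
  qed
  with d vx half inj that show ?thesis by (simp add: turn_def)
qed

end

text \<open>The conditions are those of a scheme together with 4-valence. A vertex then has at
  least three edge halfedges among its four, hence at most one stem besides the virtual
  buds.\<close>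

locale scheme = decent_map +
  assumes interior: "v \<in> vertices s \<Longrightarrow> 3 \<le> interior_degree s v"
    and four_valent: "four_valent s"
    and virtual: "virtually_rooted s \<Longrightarrow>
      rv \<rho> \<in> buds s \<and> \<sigma> \<rho> \<notin> buds s \<and> \<sigma> (rv \<rho>) \<notin> buds s"
begin

abbreviation ordinary :: "'a \<Rightarrow> bool" where
  "ordinary c \<equiv> \<not> (virtually_rooted s \<and> \<rho> \<in> vx c)"

lemma vx_vertices [simp]: "c \<in> C \<Longrightarrow> vx c \<in> vertices s"
  by (simp add: vertices_def)

lemma lessThan_4: "{..<4::nat} = {0,1,2,3}" by auto

lemma lessThan_6: "{..<6::nat} = {0,1,2,3,4,5}" by auto

lemma ordinary_turns:
  assumes c: "c \<in> C" and ord: "ordinary c"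
  shows "turn c 4 = c" "inj_on (turn c) {..<4}" "vx c = turn c ` {..<4} \<union> rv ` turn c ` {..<4}"
    "\<And>i j. i < 4 \<Longrightarrow> j < 4 \<Longrightarrow> turn c i \<notin> E \<Longrightarrow> turn c j \<notin> E \<Longrightarrow> i = j"
proof -
  obtain d where d: "d > 0" "turn c d = c" "inj_on (turn c) {..<d}"
    "vx c = turn c ` {..<d} \<union> rv ` turn c ` {..<d}"
    "halfedge_of s ` vx c = (\<lambda>i. halfedge_of s (turn c i)) ` {..<d}"
    "inj_on (\<lambda>i. halfedge_of s (turn c i)) {..<d}"
    using vertex_turns[OF c] by blast
  \<comment> \<open>A virtual bud is incident to no other vertex than the one of the root corner.\<close>
  have "halfedge_of s ` vx c \<inter> virtual_buds s = {}"
  proof (cases "virtually_rooted s")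
    case True
    then have "\<rho> \<notin> vx c" using ord by simp
    have "halfedge_of s x \<noteq> halfedge_of s y" if "x \<in> vx c" "y \<in> {\<rho>, rv \<rho>}" for x y
    proof
      assume "halfedge_of s x = halfedge_of s y"
      moreover have "x \<in> C" "y \<in> C" using that vx_C c by auto
      ultimately have "x = y \<or> x = os y" by (simp add: halfedge_of_eq_iff)
      then have "vx x = vx y" using \<open>y \<in> C\<close> by auto
      then have "vx c = vx \<rho>" using that vx_eq[of x c] by auto
      then show False using \<open>\<rho> \<notin> vx c\<close> by simp
    qed
    then show ?thesis by (auto simp: virtual_buds_def)
  qed (simp add: virtual_buds_def)
  then have "halfedge_of s ` vx c - virtual_buds s = halfedge_of s ` vx c" by blast
  moreover have "card (halfedge_of s ` vx c - virtual_buds s) = 4"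
    using four_valent c by (simp add: four_valent_def vertex_degree_def)
  ultimately have "card (halfedge_of s ` vx c) = 4" by simp
  then have "d = 4" using d(5,6) by (simp add: card_image)
  note d = d[unfolded this]
  then show "turn c 4 = c" "inj_on (turn c) {..<4}"
    "vx c = turn c ` {..<4} \<union> rv ` turn c ` {..<4}" by auto
  fix i j :: nat
  assume ij: "i < 4" "j < 4" "turn c i \<notin> E" "turn c j \<notin> E"
  show "i = j"
  proof (rule ccontr)
    assume "i \<noteq> j"
    have "halfedge_of s ` (vx c \<inter> E) \<subseteq> (\<lambda>i. halfedge_of s (turn c i)) ` ({..<4} - {i, j})"
    proof
      fix h assume "h \<in> halfedge_of s ` (vx c \<inter> E)"
      then obtain x where x: "x \<in> vx c" "x \<in> E" "h = halfedge_of s x" by blast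
      then obtain k where k: "k < 4" "halfedge_of s x = halfedge_of s (turn c k)"
        using d(5) by blast
      then have "x = turn c k \<or> x = os (turn c k)" using x c by (simp add: halfedge_of_eq_iff)
      then have "turn c k \<in> E" using x c by auto
      then show "h \<in> (\<lambda>i. halfedge_of s (turn c i)) ` ({..<4} - {i, j})"
        using ij k x by auto
    qed
    then have "card (halfedge_of s ` (vx c \<inter> E)) \<le> card ({..<4} - {i, j})"
      by (meson card_image_le card_mono finite_Diff finite_imageI finite_lessThan order_trans)
    also have "\<dots> = 2" using ij \<open>i \<noteq> j\<close> by (subst card_Diff_subset) auto
    finally show False
      using interior[OF vx_vertices[OF c]] by (simp add: interior_degree_def)
  qed
qed

lemma virtual_turns:
  assumes v: "virtually_rooted s"
  shows "turn \<rho> 6 = \<rho>" "inj_on (turn \<rho>) {..<6}" "vx \<rho> = turn \<rho> ` {..<6} \<union> rv ` turn \<rho> ` {..<6}"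
proof -
  obtain d where d: "d > 0" "turn \<rho> d = \<rho>" "inj_on (turn \<rho>) {..<d}"
    "vx \<rho> = turn \<rho> ` {..<d} \<union> rv ` turn \<rho> ` {..<d}"
    "halfedge_of s ` vx \<rho> = (\<lambda>i. halfedge_of s (turn \<rho> i)) ` {..<d}"
    "inj_on (\<lambda>i. halfedge_of s (turn \<rho> i)) {..<d}"
    using vertex_turns[OF root_C] by blast
  have "halfedge_of s \<rho> \<noteq> halfedge_of s (rv \<rho>)"
    using sg_neq[OF root_C] rv_neq[OF root_C] by (metis halfedge_of_eq_iff os_os root_C rv_C rv_os rv_rv)
  then have "card (virtual_buds s) = 2" using v by (simp add: virtual_buds_def)
  moreover have "virtual_buds s \<subseteq> halfedge_of s ` vx \<rho>"
    using v vx_refl[of \<rho>] vx_refl[of "rv \<rho>"] by (simp add: virtual_buds_def)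
  moreover have "card (halfedge_of s ` vx \<rho> - virtual_buds s) = 4"
    using four_valent by (auto simp: four_valent_def vertex_degree_def)
  moreover have "finite (halfedge_of s ` vx \<rho>)" by (simp add: finite_vx)
  ultimately have "card (halfedge_of s ` vx \<rho>) = 6"
    using card_Diff_subset[of "virtual_buds s" "halfedge_of s ` vx \<rho>"]
      card_mono[of "halfedge_of s ` vx \<rho>" "virtual_buds s"] finite_subset by fastforce
  then have "d = 6" using d(5,6) by (simp add: card_image)
  with d show "turn \<rho> 6 = \<rho>" "inj_on (turn \<rho>) {..<6}"
    "vx \<rho> = turn \<rho> ` {..<6} \<union> rv ` turn \<rho> ` {..<6}" by auto
qed

section \<open>Offset paths through a vertex\<close>

text \<open>An offset path goes through a vertex when it enters it by an edge whose halfedge has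
  relative type 1 and leaves it by one whose halfedge has relative type 0. The flags
  \<open>d\<close> and \<open>c\<close> of these two halfedges are chosen on the side with the
  larger label. The path goes on in time, from \<open>d\<close> to \<open>c\<close> and from
  \<open>\<sigma> d\<close> to \<open>\<sigma> c\<close>, unless one of the next two
  configurations occurs.\<close>

definition passage :: "'a \<Rightarrow> 'a \<Rightarrow> bool" where
  "passage d c \<longleftrightarrow> d \<in> E \<and> c \<in> E \<and> vx d = vx c \<and> l d = vertex_min c + 2 \<and> l (\<sigma> d) = vertex_min c + 1 \<and>
     l c = vertex_min c + 1 \<and> l (\<sigma> c) = vertex_min c"

text \<open>A bud leads from the corner of \<open>c\<close> (relative label 1) to the one of
  \<open>d\<close> (relative label 2), so that the first passage of the tour along the path goes
  backwards at this vertex.\<close>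

definition early_bud :: "'a \<Rightarrow> 'a \<Rightarrow> bool" where
  "early_bud d c \<longleftrightarrow> rv c \<in> buds s \<and> rv c \<in> T \<and> d \<in> T \<and> vt d = vt c + 1"

text \<open>A bud leads from the corner of \<open>\<sigma> c\<close> (relative label 0) to the one
  of \<open>\<sigma> d\<close> (relative label 1), so that the second passage of the tour along
  the path goes backwards at this vertex.\<close>

definition late_bud :: "'a \<Rightarrow> 'a \<Rightarrow> bool" where
  "late_bud d c \<longleftrightarrow> \<sigma> c \<in> buds s \<and> \<sigma> c \<in> T \<and> os d \<in> T \<and> vt (\<sigma> d) = vt (\<sigma> c) + 1"

text \<open>Four labels in cyclic order, with steps of 1 and values ranging from 0 to 2 after
  subtraction of the minimum, can only be 2, 1, 0, 1.\<close>

lemma ordinary_pattern: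
  assumes d: "d \<in> C" "ordinary d" and l: "l d = vertex_min d + 2"
  shows "l (turn d 1) = vertex_min d + 1" "l (turn d 2) = vertex_min d" "l (turn d 3) = vertex_min d + 1"
    "\<sigma> (turn d 3) = d"
proof -
  show 4: "\<sigma> (turn d 3) = d"
    using ordinary_turns(1)[OF d] turn_simps(2)[of d 3] by simp
  have t: "turn d 1 = \<sigma> d" "turn d 2 = \<sigma> (turn d 1)" "turn d 3 = \<sigma> (turn d 2)"
    by (simp_all add: turn_simps numeral_2_eq_2 numeral_3_eq_3)
  obtain x where x: "x \<in> vx d" "l x = vertex_min d" by (rule vertex_min_attained[OF d(1)])
  then obtain i where i: "i < 4" "l (turn d i) = vertex_min d"
    using ordinary_turns(3)[OF d] d by auto
  have steps: "l (turn d i) = l (\<sigma> (turn d i)) + 1 \<or> l (\<sigma> (turn d i)) = l (turn d i) + 1" for i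
    using label_step d by simp
  have "i = 0 \<or> i = 1 \<or> i = 2 \<or> i = 3" using i by auto
  moreover have "turn d 0 = d" by (simp add: turn_simps)
  ultimately show "l (turn d 1) = vertex_min d + 1" "l (turn d 2) = vertex_min d" "l (turn d 3) = vertex_min d + 1"
    using i l steps[of 0] steps[of 1] steps[of 2] steps[of 3] 4 t by auto
qed

text \<open>The virtual buds force the labels -1, 0, 1 at the corners 5, 0, 1. The corners 1 and 5
  are the first and the last but one of the tour, and the halfedges next to the virtual buds are
  not buds, so that the label drops from corner 1 to corner 2 and from corner 4 to corner 5. Only
  the label of corner 3 is left free.\<close>

lemma virtual_pattern:
  assumes v: "virtually_rooted s"
  defines "r \<equiv> turn \<rho>"
  shows "\<sigma> (r 5) = \<rho>" "l (r 1) = 1" "l (r 2) = 0" "l (r 3) = 1 \<or> l (r 3) = -1" "l (r 4) = 0"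
    "l (r 5) = -1" "vt (r 1) = 1" "\<And>i. i \<in> {2,3,4} \<Longrightarrow> 1 < vt (r i) \<and> vt (r i) < vt (r 5)"
    "vertex_min \<rho> = -1" "r 1 \<in> T" "r 5 \<in> T" "r 5 \<in> buds s" "r 0 \<notin> E" "r 5 \<notin> E" "rv (r 0) \<notin> E" "rv (r 1) \<notin> E"
    "\<And>x. x \<in> vx \<rho> \<Longrightarrow> (\<exists>i\<in>{0,1,2,3,4,5}. x = r i \<or> x = rv (r i))"
proof -
  note turns = virtual_turns[OF v, folded r_def]
  have r: "r 0 = \<rho>" "r 1 = \<sigma> \<rho>" "r 2 = \<sigma> (r 1)" "r 3 = \<sigma> (r 2)" "r 4 = \<sigma> (r 3)" "r 5 = \<sigma> (r 4)"
    by (simp_all add: r_def turn_simps eval_nat_numeral)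
  have rC [simp]: "r i \<in> C" for i by (simp add: r_def)
  have r6: "\<sigma> (r 5) = \<rho>"
    using turns(1) turn_simps(2)[of \<rho> 5] by (simp add: r_def)
  then have rv5: "\<sigma> (rv \<rho>) = rv (r 5)" "os (rv \<rho>) = r 5"
    using sg_rv_sg[OF rC[of 5]] by (auto simp: other_side_def)
  have bud: "rv \<rho> \<in> buds s" "r 1 \<notin> buds s" "rv (r 5) \<notin> buds s"
    using virtual[OF v] r rv5 by auto
  have bud5: "r 5 \<in> buds s" using os_buds[of "rv \<rho>"] bud rv5 by simp
  have T5: "r 5 \<in> T"
    using os_T_stem[of "rv \<rho>"] bud rv5 by (simp add: E_iff)
  have l5: "l (r 5) = -1" using l_bud[OF bud5 T5] r6 by simp
  have l1: "l (r 1) = 1" using l_bud[OF root_bud root_T] r by simp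
  have T1: "r 1 \<in> T" and v1: "vt (r 1) = 1" using r by simp_all
  have v5: "tour_len = vt (r 5) + 1"
  proof -
    have "r 5 \<noteq> \<rho>" using r6 sg_neq[OF rC[of 5]] by auto
    then have "vt (theta s (r 5)) = vt (r 5) + 1" using vt_theta T5 by blast
    moreover have "theta s (r 5) = \<rho>" using bud5 r6 by (simp add: theta_stem edge_corners_def)
    ultimately show ?thesis by simp
  qed
  have neq: "vt (r i) \<noteq> vt (r j)" if "i < 6" "j < 6" "i \<noteq> j" for i j
    using that turns(2) rv_turn_neq[OF root_C, of i j]
    by (auto simp: vt_eq_iff inj_on_eq_iff r_def)
  show mid: "1 < vt (r i) \<and> vt (r i) < vt (r 5)" if "i \<in> {2,3,4}" for i
    using that neq[of i 1] neq[of i 5] neq[of i 0] v1 v5 r(1) vt_bounds[OF rC[of i]] by auto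
  have l2: "l (r 2) = 0"
  proof (cases "r 1 \<in> E")
    case True
    then show ?thesis using l_edge[OF True] mid[of 2] v1 r l1 by simp
  next
    case False
    then have "r 1 \<in> leaves s" using bud E_iff rC by blast
    then show ?thesis using l_leaf T1 l1 r by simp
  qed
  have os4: "os (r 4) = rv (r 5)" using r by (simp add: other_side_def)
  have l4: "l (r 4) = 0"
  proof (cases "r 4 \<in> E")
    case True
    then show ?thesis using l_edge[OF True] mid[of 4] r l5 by simp
  next
    case False
    moreover have "r 4 \<notin> buds s" using bud os4 by (metis os_buds rC)
    ultimately have "r 4 \<in> leaves s" using E_iff rC by blast
    moreover have "r 4 \<in> T" using os_T_stem[OF rC False] T5 os4 by simp
    ultimately have "l (\<sigma> (r 4)) = l (r 4) - 1" by (rule l_leaf)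
    then show ?thesis using r l5 by simp
  qed
  have l3: "l (r 3) = 1 \<or> l (r 3) = -1"
    using label_step[OF rC[of 2]] r l2 by auto
  show vx: "\<exists>i\<in>{0,1,2,3,4,5}. x = r i \<or> x = rv (r i)" if x: "x \<in> vx \<rho>" for x
    using x unfolding turns(3) lessThan_6 by blast
  have "vertex_min \<rho> \<le> -1"
    using vertex_min_le[of \<rho> "r 5"] turns(3) l5 by auto
  moreover have "vertex_min \<rho> \<ge> -1"
  proof -
    obtain x where x: "x \<in> vx \<rho>" "l x = vertex_min \<rho>" by (rule vertex_min_attained[OF root_C])
    have "l y \<ge> -1" if y: "y \<in> vx \<rho>" for y
    proof -
      obtain i where i: "i \<in> {0,1,2,3,4,5}" "y = r i \<or> y = rv (r i)" using vx[OF y] by blast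
      then have "l y = l (r i)" by auto
      moreover have "l (r i) \<ge> -1" using i(1) l1 l2 l3 l4 l5 r(1) by (elim insertE) auto
      ultimately show ?thesis by simp
    qed
    then show ?thesis using x by metis
  qed
  ultimately show "vertex_min \<rho> = -1" by simp
  have "os \<rho> \<in> buds s" using root_bud by simp
  then have "rv (r 1) \<notin> E" using r by (simp add: edge_corners_def other_side_def)
  then show "r 0 \<notin> E" "r 5 \<notin> E" "rv (r 0) \<notin> E" "rv (r 1) \<notin> E"
    using bud(1) bud5 r(1) root_bud by (simp_all add: edge_corners_def)
  show "\<sigma> (r 5) = \<rho>" "l (r 1) = 1" "l (r 2) = 0" "l (r 3) = 1 \<or> l (r 3) = -1" "l (r 4) = 0"
    "l (r 5) = -1" "vt (r 1) = 1" "r 1 \<in> T" "r 5 \<in> T" "r 5 \<in> buds s"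
    by fact+
qed

text \<open>At an ordinary vertex the pattern is 2, 1, 0, 1. If \<open>d\<close> and
  \<open>c\<close> share the corner with label 1, the times 2, 1, 0 increase because edges are
  crossed between them. Otherwise \<open>d\<close> and \<open>c\<close> are opposite, and each of
  the two remaining halfedges of the vertex is responsible for one of the two comparisons; a bud
  reverses its comparison, and only one of the two halfedges can be a stem. At the virtual root
  vertex, the first corner of the tour comes before, and the last but one after, all corners with
  which they are compared, which leaves at most one halfedge that can reverse a
  comparison.\<close>

lemma passage_cases:
  assumes "passage d c"
  shows "(vt d < vt c \<or> early_bud d c) \<and> (vt (\<sigma> d) < vt (\<sigma> c) \<or> late_bud d c) \<and>
    \<not> (early_bud d c \<and> late_bud d c)"
proof (cases "ordinary d")
  case True
  have p: "d \<in> E" "c \<in> E" "vx d = vx c" "l d = vertex_min d + 2" "l (\<sigma> d) = vertex_min d + 1"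
    "l c = vertex_min d + 1" "l (\<sigma> c) = vertex_min d"
    using assms vertex_min_cong[of d c] by (auto simp: passage_def)
  then have dC: "d \<in> C" "c \<in> C" by auto
  define t where "t = turn d"
  have t: "t 0 = d" "t 1 = \<sigma> d" "t 2 = \<sigma> (t 1)" "t 3 = \<sigma> (t 2)"
    by (simp_all add: t_def turn_simps eval_nat_numeral)
  have tC [simp]: "t i \<in> C" for i using dC by (simp add: t_def)
  note pat = ordinary_pattern[OF dC(1) True p(4), folded t_def]
  have "c \<in> vx d" using p(3) vx_refl[of c] by simp
  then obtain i where i: "i < 4" "c = t i \<or> c = rv (t i)"
    using ordinary_turns(3)[OF dC(1) True] by (auto simp: t_def)
  then have "l (t i) = vertex_min d + 1" using p by auto
  then have "i = 1 \<or> i = 3" using i pat p(4) t(1) by (cases "i = 0"; cases "i = 2") auto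
  moreover have "c \<noteq> t 3" "c \<noteq> rv (t 1)" using pat p t sg_rv_sg[OF dC(1)] by auto
  ultimately consider "c = t 1" | "c = rv (t 3)" using i by auto
  then show ?thesis
  proof cases
    case 1
    have "vt d < vt (\<sigma> d)" using p by (intro drop_edge) auto
    moreover have "vt c < vt (\<sigma> c)" using p by (intro drop_edge) auto
    ultimately show ?thesis using 1 t by (simp add: early_bud_def)
  next
    case 2
    have sc: "\<sigma> c = rv (t 2)" using 2 t sg_rv_sg[OF tC[of 2]] by simp
    have sd: "\<sigma> (rv d) = c" using 2 pat sg_rv_sg[OF tC[of 3]] by simp
    have "vt (rv d) < vt (\<sigma> (rv d)) \<or> (os (rv d) \<in> buds s \<and> os (rv d) \<in> T \<and> rv (rv d) \<in> T \<and>
        vt (rv d) = vt (\<sigma> (rv d)) + 1)"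
      using p dC sd by (intro drop_cases) simp_all
    moreover have "os (rv d) = rv c" using sd by (simp add: other_side_def)
    ultimately have A: "vt d < vt c \<or> early_bud d c" using sd dC by (auto simp: early_bud_def)
    have "vt (\<sigma> d) < vt (\<sigma> (\<sigma> d)) \<or> (os (\<sigma> d) \<in> buds s \<and> os (\<sigma> d) \<in> T \<and> rv (\<sigma> d) \<in> T \<and>
        vt (\<sigma> d) = vt (\<sigma> (\<sigma> d)) + 1)"
      using p dC pat t by (intro drop_cases) simp_all
    moreover have "os (\<sigma> d) = \<sigma> c" "rv (\<sigma> d) = os d" "vt (\<sigma> (\<sigma> d)) = vt (\<sigma> c)"
      using sc t dC by (simp_all add: other_side_def)
    ultimately have B: "vt (\<sigma> d) < vt (\<sigma> c) \<or> late_bud d c" by (auto simp: late_bud_def)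
    have "\<not> (early_bud d c \<and> late_bud d c)"
    proof
      assume "early_bud d c \<and> late_bud d c"
      then have "t 3 \<in> buds s" "os (t 1) \<in> buds s"
        using 2 \<open>os (\<sigma> d) = \<sigma> c\<close> t by (auto simp: early_bud_def late_bud_def)
      then have "t 3 \<notin> E" "t 1 \<notin> E" by (auto simp: edge_corners_def)
      then show False
        using ordinary_turns(4)[OF dC(1) True, of 3 1] by (simp add: t_def)
    qed
    with A B show ?thesis by blast
  qed
next
  case False
  then have v: "virtually_rooted s" and "\<rho> \<in> vx d" by auto
  then have vx: "vx d = vx \<rho>" using vx_eq by simp
  define r where "r = turn \<rho>"
  note pat = virtual_pattern[OF v, folded r_def]
  have rC [simp]: "r i \<in> C" for i by (simp add: r_def)
  have r: "r 0 = \<rho>" "r 1 = \<sigma> \<rho>" "\<sigma> (r 1) = r 2" "\<sigma> (r 2) = r 3" "\<sigma> (r 3) = r 4" "\<sigma> (r 4) = r 5"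
    by (simp_all add: r_def turn_simps eval_nat_numeral)
  have rv: "\<sigma> (rv (r 2)) = rv (r 1)" "\<sigma> (rv (r 3)) = rv (r 2)" "\<sigma> (rv (r 4)) = rv (r 3)"
    "\<sigma> (rv (r 5)) = rv (r 4)"
    using sg_rv_sg[OF rC] r by metis+
  have m: "vertex_min c = -1" using assms vx pat(9) vertex_min_cong[of c \<rho>] by (simp add: passage_def)
  have p: "d \<in> E" "c \<in> E" "vx c = vx \<rho>" "l d = 1" "l (\<sigma> d) = 0" "l c = 0" "l (\<sigma> c) = -1"
    using assms vx m by (auto simp: passage_def)
  have dC: "d \<in> C" "c \<in> C" using p by auto
  have "d \<in> vx \<rho>" "c \<in> vx \<rho>" using vx p vx_refl[of d] vx_refl[of c] by auto
  obtain i where i: "i \<in> {0,1,2,3,4,5}" "d = r i \<or> d = rv (r i)"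
    using pat(17)[OF \<open>d \<in> vx \<rho>\<close>] by blast
  obtain j where j: "j \<in> {0,1,2,3,4,5}" "c = r j \<or> c = rv (r j)"
    using pat(17)[OF \<open>c \<in> vx \<rho>\<close>] by blast
  have "l (r i) = 1" "l (r j) = 0" using i j p by auto
  then have ij: "i = 1 \<or> i = 3 \<and> l (r 3) = 1" "j = 0 \<or> j = 2 \<or> j = 4"
    using i(1) j(1) pat(2-6) l_root r(1) by (elim insertE; simp)+
  have d_cases: "d = r 1 \<or> (d = r 3 \<or> d = rv (r 3)) \<and> l (r 3) = 1"
    using ij(1) i(2) p pat by auto
  have "c \<noteq> rv (r 2)" using rv(1) p pat by auto
  then have c_cases: "c = r 4 \<or> (c = r 2 \<or> c = rv (r 4)) \<and> l (r 3) = -1"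
    using ij(2) j(2) p pat r rv by auto
  have mid: "1 < vt (r 2)" "1 < vt (r 3)" "1 < vt (r 4)"
    "vt (r 2) < vt (r 5)" "vt (r 3) < vt (r 5)" "vt (r 4) < vt (r 5)"
    using pat(8)[of 2] pat(8)[of 3] pat(8)[of 4] by auto
  have dd: "vt d < vt (\<sigma> d)" "vt c < vt (\<sigma> c)" using p by (auto intro!: drop_edge)
  consider "d = r 1" "c = r 4" | "d = r 1" "c = r 2" | "d = r 1" "c = rv (r 4)" "l (r 3) = -1"
    | "d = r 3" "c = r 4" | "d = rv (r 3)" "c = r 4" "l (r 3) = 1"
    using d_cases c_cases by force
  then show ?thesis
  proof cases
    case 1
    then show ?thesis using mid pat(7) r by (auto simp: early_bud_def)
  next
    case 2
    then show ?thesis using dd r by (auto simp: early_bud_def)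
  next
    case 3
    have *: "\<sigma> c = rv (r 3)" "\<sigma> d = r 2" using 3 rv r by auto
    have "vt (r 2) < vt (\<sigma> (r 2)) \<or> (os (r 2) \<in> buds s \<and> os (r 2) \<in> T \<and> rv (r 2) \<in> T \<and>
        vt (r 2) = vt (\<sigma> (r 2)) + 1)"
      using 3 pat r by (intro drop_cases) simp_all
    moreover have "os (r 2) = \<sigma> c" "rv (r 2) = os d" "vt (\<sigma> (r 2)) = vt (\<sigma> c)"
      using * r by (simp_all add: other_side_def)
    ultimately have "vt (\<sigma> d) < vt (\<sigma> c) \<or> late_bud d c"
      using * by (auto simp: late_bud_def)
    then show ?thesis using 3 mid pat(7) by (auto simp: early_bud_def)
  next
    case 4
    then show ?thesis using dd r by (auto simp: early_bud_def)
  next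
    case 5
    have *: "\<sigma> c = r 5" "\<sigma> d = rv (r 2)" using 5 rv r by auto
    have "vt (r 3) < vt (\<sigma> (r 3)) \<or> (os (r 3) \<in> buds s \<and> os (r 3) \<in> T \<and> rv (r 3) \<in> T \<and>
        vt (r 3) = vt (\<sigma> (r 3)) + 1)"
      using 5 pat r by (intro drop_cases) simp_all
    moreover have "os (r 3) = rv c" "rv (r 3) = d" "vt (r 3) = vt d" "vt (\<sigma> (r 3)) = vt c"
      using 5 r by (simp_all add: other_side_def)
    ultimately have "vt d < vt c \<or> early_bud d c" by (auto simp: early_bud_def)
    then show ?thesis using * mid by (auto simp: late_bud_def)
  qed
qed

text \<open>An edge of the path is recognized from the corner with label 2 from which the tour
  enters it, or from the corner with label 0 at which the tour leaves it. Both corners are unique in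
  the pattern 2, 1, 0, 1. At the virtual root vertex the corner 5 is the only minimum or the
  corner 1 the only maximum, according to the label of corner 3.\<close>

lemma passage_unique:
  assumes p: "passage d c" "passage d' c'" and vx: "vx d = vx d'"
    and T: "d \<in> T" "d' \<in> T" "\<sigma> c \<in> T" "\<sigma> c' \<in> T"
  shows "d = d' \<or> c = c'" "ordinary d \<Longrightarrow> d = d' \<and> c = c'"
proof -
  have C: "d \<in> C" "d' \<in> C" "c \<in> C" "c' \<in> C" using p by (auto simp: passage_def)
  have e: "vx c = vx d" "vx c' = vx d" using p vx by (metis passage_def)+
  have m: "vertex_min c = vertex_min d" "vertex_min c' = vertex_min d" by (intro vertex_min_cong e)+
  then have l: "l d = vertex_min d + 2" "l d' = vertex_min d + 2" "l (\<sigma> c) = vertex_min d" "l (\<sigma> c') = vertex_min d"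
    using p by (metis passage_def)+
  have mem: "d' \<in> vx d" "\<sigma> c \<in> vx d" "\<sigma> c' \<in> vx d"
    using e vx C vx_refl[of d'] vx_refl[of "\<sigma> c"] vx_refl[of "\<sigma> c'"] by auto
  have bottom: "c = c'" if "\<sigma> c = x \<or> \<sigma> c = rv x" "\<sigma> c' = x \<or> \<sigma> c' = rv x" "x \<in> C" for x
  proof -
    have "\<sigma> c = \<sigma> c'" using that T by auto
    then show ?thesis using C sg_eq_imp by blast
  qed
  have top: "d = d'" if "d = x \<or> d = rv x" "d' = x \<or> d' = rv x" "x \<in> C" for x
    using that T by auto
  show ord: "d = d' \<and> c = c'" if o: "ordinary d"
  proof -
    have turns: "\<exists>i \<in> {0,1,2,3}. x = turn d i \<or> x = rv (turn d i)" if "x \<in> vx d" for x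
      using that ordinary_turns(3)[OF C(1) o] unfolding lessThan_4 by auto
    have lt: "l (turn d 0) = vertex_min d + 2" "turn d 0 = d" using l by (simp_all add: turn_simps)
    note pat = ordinary_pattern[OF C(1) o l(1)]
    have "x = d \<or> x = rv d" if "x \<in> vx d" "l x = vertex_min d + 2" for x
      using turns[OF that(1)] that(2) pat lt C by auto
    moreover have "x = turn d 2 \<or> x = rv (turn d 2)" if "x \<in> vx d" "l x = vertex_min d" for x
      using turns[OF that(1)] that(2) pat lt C by auto
    ultimately show ?thesis using top[of d] bottom[of "turn d 2"] l mem C by auto
  qed
  show "d = d' \<or> c = c'"
  proof (cases "ordinary d")
    case True
    then show ?thesis using ord by simp
  next
    case False
    then have v: "virtually_rooted s" and "\<rho> \<in> vx d" by auto
    then have vx: "vx d = vx \<rho>" using vx_eq by simp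
    define r where "r = turn \<rho>"
    note pat = virtual_pattern[OF v, folded r_def]
    have rC [simp]: "r i \<in> C" for i by (simp add: r_def)
    have r0: "l (r 0) = 0" by (simp add: r_def turn_simps)
    have m: "vertex_min d = -1" using pat(9) vertex_min_cong[OF vx] by simp
    show ?thesis
    proof (cases "l (r 3) = 1")
      case True
      have "x = r 5 \<or> x = rv (r 5)" if "x \<in> vx \<rho>" "l x = -1" for x
      proof -
        obtain i where i: "i \<in> {0,1,2,3,4,5}" "x = r i \<or> x = rv (r i)" using pat(17) \<open>x \<in> vx \<rho>\<close> by blast
        then have "l (r i) = -1" using \<open>l x = -1\<close> by auto
        then have "i = 5" using i(1) pat(2,3,5) True r0 by (elim insertE; simp)
        then show ?thesis using i by simp
      qed
      then show ?thesis using bottom[of "r 5"] mem l vx m by simp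
    next
      case False
      have "x = r 1 \<or> x = rv (r 1)" if "x \<in> vx \<rho>" "l x = 1" for x
      proof -
        obtain i where i: "i \<in> {0,1,2,3,4,5}" "x = r i \<or> x = rv (r i)" using pat(17) \<open>x \<in> vx \<rho>\<close> by blast
        then have "l (r i) = 1" using \<open>l x = 1\<close> by auto
        then have "i = 1" using i(1) pat(2-6) False r0 by (elim insertE; auto)
        then show ?thesis using i by simp
      qed
      then show ?thesis using top[of "r 1"] mem l vx m vx_refl[of d] by simp
    qed
  qed
qed

end

section \<open>Offset cycles\<close>

text \<open>Times \<open>m j\<close> attached to the distinct vertices \<open>v j\<close> of a
  cycle may drop only by 2, and then the skipped time \<open>a j\<close> belongs to the vertex
  \<open>v j\<close> as well. Going backwards from the minimum, the times must be \<open>m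
  w\<close>, \<open>m w + 2\<close>, \<open>m w + 4\<close>, and so on: a value below the last one
  would fall on a time that already belongs to another vertex. Hence there is a drop at every
  vertex but one.\<close>

lemma cyclic_descent:
  fixes m a :: "int \<Rightarrow> nat" and k :: int
  assumes inj: "\<And>i j. v i = v j \<Longrightarrow> k dvd i - j"
    and own: "\<And>j. own (m j) = v j" "\<And>j. own (a j) = v j"
    and step: "\<And>j. m j = a j + 1 \<and> m j = m (j + 1) + 2 \<or> m j < m (j + 1)"
  shows "\<exists>w. \<forall>r. 0 < r \<longrightarrow> r < k \<longrightarrow> m (w - r) = a (w - r) + 1 \<and> m (w - r) = m (w - r + 1) + 2"
proof -
  obtain w where w: "\<And>j. m w \<le> m j"
    using ex_has_least_nat[of "\<lambda>_. True" 0 m] by auto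
  have eq_imp: "k dvd i - j" if "m i = m j \<or> m i = a j" for i j
    using that own inj by metis
  have "m (w - int r) = m w + 2 * r \<and> (0 < r \<longrightarrow> m (w - int r) = a (w - int r) + 1)" if "int r < k" for r
    using that
  proof (induction r rule: less_induct)
    case (less r)
    show ?case
    proof (cases r)
      case (Suc q)
      define j where "j = w - int r"
      have IH: "m (w - int i) = m w + 2 * i \<and> (0 < i \<longrightarrow> m (w - int i) = a (w - int i) + 1)" if "i \<le> q" for i
        using less.IH[of i] less.prems that Suc by auto
      have no_eq: "m j \<noteq> m (w - int i)" "m j \<noteq> a (w - int i)" if "i \<le> q" for i
      proof -
        have "\<not> k dvd int r - int i"
          using zdvd_imp_le[of k "int r - int i"] that Suc less.prems by auto
        then have "\<not> k dvd int i - int r" by (simp add: dvd_diff_commute)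
        then have "\<not> k dvd j - (w - int i)" by (simp add: j_def)
        then show "m j \<noteq> m (w - int i)" "m j \<noteq> a (w - int i)" using eq_imp by blast+
      qed
      have j1: "j + 1 = w - int q" using Suc by (simp add: j_def)
      have "\<not> m j < m (j + 1)"
      proof
        assume "m j < m (j + 1)"
        then have "m j < m w + 2 * q" using IH[of q] j1 by simp
        moreover have "m w \<le> m j" by (rule w)
        ultimately obtain x where x: "m j = m w + x" "x < 2 * q" by (metis le_iff_add nat_add_left_cancel_less)
        show False
        proof (cases "even x")
          case True
          then obtain i where "x = 2 * i" by blast
          then show False using x IH[of i] no_eq(1)[of i] by simp
        next
          case False
          then obtain i where "x = 2 * i + 1" by (rule oddE)
          moreover from this have "Suc i \<le> q" using x by simp
          ultimately show False using x IH[of "Suc i"] no_eq(2)[of "Suc i"] by simp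
        qed
      qed
      then have "m j = a j + 1 \<and> m j = m (j + 1) + 2" using step by blast
      then show ?thesis using IH[of q] j1 Suc by (simp add: j_def)
    qed simp
  qed
  then have *: "m (w - r) = m w + 2 * nat r \<and> (0 < r \<longrightarrow> m (w - r) = a (w - r) + 1)"
    if "0 \<le> r" "r < k" for r
    using that by (metis int_nat_eq zero_less_nat_eq nonneg_int_cases of_nat_0_less_iff nat_int)
  have "m (w - r) = a (w - r) + 1 \<and> m (w - r) = m (w - r + 1) + 2" if r: "0 < r" "r < k" for r
  proof -
    have "m (w - r + 1) = m w + 2 * nat (r - 1)" using *[of "r - 1"] r by (simp add: algebra_simps)
    moreover have "nat r = Suc (nat (r - 1))" using r by simp
    ultimately show ?thesis using *[of r] r by simp
  qed
  then show ?thesis by blast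
qed

context scheme
begin

text \<open>Of the two sides of an offset edge, the flag lies on the one with the larger labels, at the
  end from which the edge is offset.\<close>

definition offset_flag :: "'a \<Rightarrow> bool" where
  "offset_flag c \<longleftrightarrow> c \<in> E \<and> l c = vertex_min c + 1 \<and> l (\<sigma> c) = vertex_min c \<and>
     l (mate c) = vertex_min (mate c) + 2 \<and> l (\<sigma> (mate c)) = vertex_min (mate c) + 1"

definition loop_cycle :: "'a \<Rightarrow> bool" where
  "loop_cycle c \<longleftrightarrow> offset_flag c \<and> vx (mate c) = vx c \<and> mate c \<in> T \<and> os (mate c) \<in> T"

text \<open>The edge of \<open>c0\<close> enters the vertex with the early bud and leaves the one
  with the late bud.\<close>

definition two_cycle :: "'a \<Rightarrow> 'a \<Rightarrow> bool" where
  "two_cycle c0 c1 \<longleftrightarrow> offset_flag c0 \<and> offset_flag c1 \<and> vx (mate c0) = vx c1 \<and> vx (mate c1) = vx c0 \<and>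
     vx c0 \<noteq> vx c1 \<and> early_bud (mate c0) c1 \<and> late_bud (mate c1) c0"

lemma offset_flag_E: "offset_flag c \<Longrightarrow> c \<in> E"
  by (simp add: offset_flag_def)

lemma edge_of_eq: "edge_of s c = {c, os c, mate c, os (mate c)}"
  by (auto simp: edge_of_def halfedge_of_def)

lemma edge_of_cong:
  assumes "c \<in> E" "c' \<in> edge_of s c"
  shows "edge_of s c' = edge_of s c"
proof -
  have "c' = c \<or> c' = os c \<or> c' = mate c \<or> c' = os (mate c)" using assms by (auto simp: edge_of_eq)
  moreover have "mate (os c) = os (mate c)" "mate (os (mate c)) = os c"
    using assms mate_os[of c] mate_os[of "mate c"] by auto
  ultimately show ?thesis using assms by (elim disjE) (auto simp: edge_of_eq)
qed

lemma edge_of_eqD: "edge_of s c = edge_of s c' \<Longrightarrow> c' = c \<or> c' = os c \<or> c' = mate c \<or> c' = os (mate c)"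
  by (metis edge_of_eq empty_iff insertCI insertE)

lemma offset_flag_unique:
  assumes "offset_flag c" "offset_flag c'" "edge_of s c = edge_of s c'"
  shows "c = c'"
proof -
  have c: "c \<in> C" "mate c \<in> C" using assms(1) by (auto simp: offset_flag_def)
  have "vertex_min (os c) = vertex_min c" "vertex_min (os (mate c)) = vertex_min (mate c)" by (auto intro!: vertex_min_cong simp: c)
  then show ?thesis
    using edge_of_eqD[OF assms(3)] assms(1,2) c unfolding offset_flag_def by auto
qed

text \<open>The flag in the definition of offset edges may lie on either side. That the side with
  the larger label at one end also has the larger label at the other end is
  \<open>side_order\<close>.\<close>

lemma offset_toward_iff:
  "offset_toward s l e u v \<longleftrightarrow> (\<exists>c. offset_flag c \<and> e = edge_of s c \<and> u = vx c \<and> v = vx (mate c))"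
proof
  assume "\<exists>c. offset_flag c \<and> e = edge_of s c \<and> u = vx c \<and> v = vx (mate c)"
  then show "offset_toward s l e u v"
    unfolding offset_toward_def offset_flag_def
    by (auto simp: relative_type_def relative_label_def vertex_min_def[symmetric] vertex_min_cong[of "\<sigma> _"])
next
  assume "offset_toward s l e u v"
  then obtain c where c: "c \<in> E" "e = edge_of s c" "u = vx c" "v = vx (mate c)"
    and rt: "relative_type s l c = 0" "relative_type s l (mate c) = 1"
    unfolding offset_toward_def by blast
  have C: "c \<in> C" "mate c \<in> C" using c by auto
  have rt_eq: "relative_type s l x = min (l x) (l (\<sigma> x)) - vertex_min x" if "x \<in> C" for x
    using that by (auto simp: relative_type_def relative_label_def vertex_min_def)
  have flag: "offset_flag x" if x: "x \<in> E" "vt x < vt (\<sigma> x)"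
    "relative_type s l x = 0" "relative_type s l (mate x) = 1" for x
    using x l_edge[of x] l_edge[of "mate x"] side_order[OF x(1,2)] rt_eq[of x] rt_eq[of "mate x"]
    by (auto simp: offset_flag_def)
  show "\<exists>c. offset_flag c \<and> e = edge_of s c \<and> u = vx c \<and> v = vx (mate c)"
  proof (cases "vt c < vt (\<sigma> c)")
    case True
    then show ?thesis using flag c rt by blast
  next
    case False
    then have "vt (\<sigma> c) < vt c" using vt_sg_neq[OF C(1)] by simp
    have vertex_min_os: "vertex_min (os x) = vertex_min x" if "x \<in> C" for x using that by (intro vertex_min_cong) simp
    have "offset_flag (os c)"
    proof (rule flag)
      show "os c \<in> E" using c by simp
      show "vt (os c) < vt (\<sigma> (os c))"
        using \<open>vt (\<sigma> c) < vt c\<close> C by (simp add: other_side_def)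
      show "relative_type s l (os c) = 0" "relative_type s l (mate (os c)) = 1"
        using rt C c rt_eq[of c] rt_eq[of "mate c"] rt_eq[of "os c"] rt_eq[of "os (mate c)"]
        by (simp_all add: vertex_min_os mate_os min.commute)
    qed
    moreover have "edge_of s (os c) = edge_of s c" using c by (intro edge_of_cong) (auto simp: edge_of_eq)
    ultimately show ?thesis using c C by (intro exI[of _ "os c"]) (simp add: mate_os)
  qed
qed

lemma offset_arcs: "e \<in> arcs (offset_graph s l) \<longleftrightarrow> (\<exists>c. offset_flag c \<and> e = edge_of s c)"
  by (auto simp: offset_graph_def offset_toward_iff)

lemma offset_tail: "offset_flag c \<Longrightarrow> tail (offset_graph s l) (edge_of s c) = vx c"
  using offset_flag_unique by (auto simp: offset_graph_def offset_toward_iff intro!: the_equality)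

lemma offset_head: "offset_flag c \<Longrightarrow> head (offset_graph s l) (edge_of s c) = vx (mate c)"
  using offset_flag_unique by (auto simp: offset_graph_def offset_toward_iff intro!: the_equality)

lemma passage_offset_flags:
  assumes "offset_flag c" "offset_flag c'" "vx (mate c) = vx c'"
  shows "passage (mate c) c'"
  using assms vertex_min_cong[OF assms(3)] by (auto simp: offset_flag_def passage_def)

text \<open>The buds fix the direction of the tour at both ends of both edges: each edge is always
  traversed from the vertex toward which it is offset.\<close>

lemma two_cycle_T:
  assumes "two_cycle c0 c1"
  shows "mate c0 \<in> T" "os (mate c0) \<in> T" "mate c1 \<in> T" "os (mate c1) \<in> T"
proof -
  have E: "c0 \<in> E" "c1 \<in> E" using assms by (auto simp: two_cycle_def offset_flag_def)
  then have C: "c0 \<in> C" "c1 \<in> C" by auto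
  show "mate c0 \<in> T" "os (mate c1) \<in> T"
    using assms by (auto simp: two_cycle_def early_bud_def late_bud_def)
  have "rv c1 \<in> T" "\<sigma> c0 \<in> T" using assms by (auto simp: two_cycle_def early_bud_def late_bud_def)
  then have "c1 \<notin> T" "os c0 \<notin> T" using C by (auto simp: other_side_def)
  then show "mate c1 \<in> T" "os (mate c0) \<in> T"
    using E mate_T[of c1] mate_T[of "os c0"] by (auto simp: mate_os)
qed

lemma vx_tour_at_vt: assumes "c \<in> C" shows "vx (tour_at (vt c)) = vx c"
proof (cases "c \<in> T")
  case False
  then have "rv c \<in> T" using assms by simp
  then have "tour_at (vt c) = rv c" using vt_T(3) assms by fastforce
  then show ?thesis using assms by simp
qed (simp add: vt_T)

text \<open>Let \<open>m j\<close> be the time of the corner with relative label 2 next to the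
  incoming edge, and \<open>M j\<close> the time of the corner with relative label 0 next to the
  outgoing edge. Both increase along the cycle, except that \<open>m\<close> drops by 2 after an
  early bud and \<open>M\<close> drops by 2 on arriving at a late bud. In a cycle of length at
  least 2 the increase is strict; by \<open>cyclic_descent\<close> there are early buds at all
  vertices but one, so that \<open>M\<close> increases except at that one vertex, where the single
  drop by 2 has to make up for all the increases. This leaves room for only one of them, since the
  time skipped by the drop belongs to the vertex with the late bud.\<close>

lemma cyclic_offset_flags:
  fixes c :: "int \<Rightarrow> 'a" and k :: int
  assumes k: "k > 0" and per: "\<And>j. c (j + k) = c j" and flag: "\<And>j. offset_flag (c j)"
    and adj: "\<And>j. vx (mate (c j)) = vx (c (j + 1))"
    and inj: "\<And>i j. vx (c i) = vx (c j) \<Longrightarrow> k dvd i - j"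
  shows "k = 1 \<and> loop_cycle (c 0) \<or> k = 2 \<and> (two_cycle (c 0) (c 1) \<or> two_cycle (c 1) (c 0))"
proof -
  define d where "d j = mate (c (j - 1))" for j
  have cE [simp]: "c j \<in> E" and dE [simp]: "d j \<in> E" for j using flag by (auto simp: d_def offset_flag_def)
  have C [simp]: "c j \<in> C" "d j \<in> C" for j by auto
  have vxd: "vx (d j) = vx (c j)" for j using adj[of "j - 1"] by (simp add: d_def)
  have p: "passage (d j) (c j)" for j
    using passage_offset_flags[OF flag flag] vxd by (simp add: d_def)
  note cases = passage_cases[OF p]
  have mate_c: "mate (c j) = d (j + 1)" for j by (simp add: d_def)
  have mate_os_c: "mate (os (c j)) = os (d (j + 1))" for j by (simp add: mate_os mate_c)
  have vt_os: "vt (os x) = vt (\<sigma> x)" if "x \<in> C" for x using that by (simp add: other_side_def)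
  define m a M b where "m j = vt (d j)" and "a j = vt (c j)" and "M j = vt (\<sigma> (c j))"
    and "b j = vt (\<sigma> (d j))" for j
  have ma: "c j \<notin> T \<and> d (j + 1) \<in> T \<and> a j = m (j + 1) + 1 \<or> c j \<in> T \<and> m (j + 1) = a j + 1" for j
    using vt_mate_cases[OF cE[of j]] by (auto simp: mate_c m_def a_def)
  have Mb: "os (d (j + 1)) \<in> T \<and> M j = b (j + 1) + 1 \<or> os (d (j + 1)) \<notin> T \<and> b (j + 1) = M j + 1" for j
    using vt_mate_cases[of "os (c j)"] by (auto simp: mate_os_c M_def b_def vt_os)
  have own: "vx (tour_at (m j)) = vx (c j)" "vx (tour_at (a j)) = vx (c j)" "vx (tour_at (M j)) = vx (c j)"
    "vx (tour_at (b j)) = vx (c j)" for j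
    by (simp_all add: m_def a_def M_def b_def vx_tour_at_vt vxd)
  have early: "m j = a j + 1 \<and> m j = m (j + 1) + 2" if "early_bud (d j) (c j)" for j
    using that ma[of j] by (auto simp: early_bud_def m_def a_def)
  have late: "b j = M j + 1 \<and> M (j - 1) = M j + 2" if "late_bud (d j) (c j)" for j
    using that Mb[of "j - 1"] by (auto simp: late_bud_def M_def b_def)
  have not_early: "m j < a j" if "\<not> early_bud (d j) (c j)" for j
    using that cases[of j] by (auto simp: m_def a_def)
  have not_late: "b j < M j" if "\<not> late_bud (d j) (c j)" for j
    using that cases[of j] by (auto simp: M_def b_def)
  show ?thesis
  proof (cases "k = 1")
    case True
    then have const: "c 1 = c 0" using per[of 0] by simp
    have d: "d 1 = mate (c 0)" by (simp add: d_def)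
    have c': "c (-1) = c 0" using per[of "-1"] True by simp
    then have d0: "d 0 = d 1" by (simp add: d_def)
    \<comment> \<open>A drop by 2 is impossible when the next vertex of the cycle is the same.\<close>
    have ne: "\<not> early_bud (d 0) (c 0)" "\<not> late_bud (d 0) (c 0)"
      using early[of 0] late[of 0] d0 c' by (auto simp: m_def M_def)
    have "d 1 \<in> T" using ma[of 0] not_early[OF ne(1)] d0 by (auto simp: m_def)
    moreover have "os (d 1) \<in> T" using Mb[of 0] not_late[OF ne(2)] d0 by (auto simp: b_def)
    ultimately have "loop_cycle (c 0)"
      using flag[of 0] d vxd[of 1] const by (simp add: loop_cycle_def)
    then show ?thesis using True by simp
  next
    case False
    then have k2: "k \<ge> 2" using k by simp
    have not_dvd: "\<not> k dvd 1" using k2 by (auto dest: zdvd_imp_le)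
    have m_neq: "m j \<noteq> m (j + 1)" for j
    proof
      assume "m j = m (j + 1)"
      then have "vx (c (j + 1)) = vx (c j)" using own(1) by metis
      then show False using inj[of "j + 1" j] not_dvd by simp
    qed
    have M_neq: "M (j - 1) \<noteq> M j" for j
    proof
      assume "M (j - 1) = M j"
      then have "vx (c j) = vx (c (j - 1))" using own(3) by metis
      then show False using inj[of j "j - 1"] not_dvd by simp
    qed
    have "\<exists>w. \<forall>r. 0 < r \<longrightarrow> r < k \<longrightarrow> m (w - r) = a (w - r) + 1 \<and> m (w - r) = m (w - r + 1) + 2"
    proof (rule cyclic_descent)
      show "m j = a j + 1 \<and> m j = m (j + 1) + 2 \<or> m j < m (j + 1)" for j
      proof (cases "early_bud (d j) (c j)")
        case True
        then show ?thesis using early by blast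
      next
        case False
        then show ?thesis using not_early[OF False] ma[of j] m_neq[of j] by auto
      qed
    qed (fact inj own)+
    then obtain w where w: "\<And>r. 0 < r \<Longrightarrow> r < k \<Longrightarrow> m (w - r) = a (w - r) + 1" by blast
    have Ew: "early_bud (d (w - r)) (c (w - r))" if "0 < r" "r < k" for r
      using w[OF that] not_early[of "w - r"] by fastforce
    have rise: "M (j - 1) < M j" if "\<not> late_bud (d j) (c j)" for j
      using not_late[OF that] Mb[of "j - 1"] M_neq[of j] by auto
    have rise_w: "M (w - r - 1) < M (w - r)" if "0 < r" "r < k" for r
      using Ew[OF that] cases[of "w - r"] by (intro rise) blast
    \<comment> \<open>The increases of \<open>M\<close> at the other vertices have to be compensated at \<open>w\<close>.\<close>
    have perM: "M (w - k) = M w" using per[of "w - k"] by (simp add: M_def)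
    have chain: "M (w - 1 - int q) + q \<le> M (w - 1)" if "int q < k" for q
      using that
    proof (induction q)
      case (Suc q)
      then show ?case using rise_w[of "1 + int q"] by (simp add: algebra_simps)
    qed simp
    have "M w + nat (k - 1) \<le> M (w - 1)" using chain[of "nat (k - 1)"] k perM by simp
    then have "M w < M (w - 1)" using k2 by simp
    then have Lw: "late_bud (d w) (c w)" using rise[of w] by fastforce
    have "k = 2"
    proof (rule ccontr)
      assume "k \<noteq> 2"
      then have k3: "k \<ge> 3" using k2 by simp
      have "M w < M (w - 2) \<and> M (w - 2) < M (w - 1)"
      proof -
        have chain2: "M (w - 2 - int q) + q \<le> M (w - 2)" if "int q < k - 1" for q
          using that
        proof (induction q)
          case (Suc q)
          then show ?case using rise_w[of "2 + int q"] by (simp add: algebra_simps)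
        qed simp
        have "M w + nat (k - 2) \<le> M (w - 2)" using chain2[of "nat (k - 2)"] k3 perM by simp
        then show ?thesis using rise_w[of 1] k3 by simp
      qed
      then have "M (w - 2) = b w" using late[OF Lw] by simp
      then have "vx (c w) = vx (c (w - 2))" using own(3,4) by metis
      then have "k dvd 2" using inj[of w "w - 2"] by simp
      then show False using k3 by (auto dest: zdvd_imp_le)
    qed
    have per2: "c (j + 2) = c j" for j using per \<open>k = 2\<close> by simp
    have "d (w - 1) = mate (c w)" using per2[of "w - 2"] by (simp add: d_def)
    moreover have "d w = mate (c (w - 1))" by (simp add: d_def)
    moreover have "vx (c w) \<noteq> vx (c (w - 1))"
      using inj[of w "w - 1"] not_dvd by auto
    ultimately have two: "two_cycle (c w) (c (w - 1))"
      using Ew[of 1] Lw k2 flag vxd[of "w - 1"] vxd[of w] by (simp add: two_cycle_def)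
    have parity: "c i = c j" if "even (i - j)" for i j
    proof -
      have step: "c (x + 2 * int q) = c x" for x q
        by (induction q) (use per2 in \<open>simp_all add: algebra_simps, metis add.commute add.left_commute\<close>)
      obtain t where t: "i - j = 2 * t" using \<open>even (i - j)\<close> by blast
      show ?thesis
      proof (cases "t \<ge> 0")
        case True
        then show ?thesis using step[of j "nat t"] t by (simp add: algebra_simps)
      next
        case False
        then show ?thesis using step[of i "nat (- t)"] t by (simp add: algebra_simps)
      qed
    qed
    show ?thesis
    proof (cases "even w")
      case True
      then have "c w = c 0" "c (w - 1) = c 1" by (auto intro!: parity)
      then show ?thesis using two \<open>k = 2\<close> by simp
    next
      case False
      then have "c w = c 1" "c (w - 1) = c 0" by (auto intro!: parity)
      then show ?thesis using two \<open>k = 2\<close> by simp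
    qed
  qed
qed

end

context pre_digraph
begin

lemma tl_awalk_verts: "cas u p v \<Longrightarrow> tl (awalk_verts u p) = map (head G) p"
proof (induction p arbitrary: u)
  case (Cons e p)
  then show ?case by (cases p) auto
qed simp

lemma cas_ends: "cas u p v \<Longrightarrow> p \<noteq> [] \<Longrightarrow> tail G (p ! 0) = u \<and> head G (p ! (length p - 1)) = v"
proof (induction p arbitrary: u)
  case (Cons e p)
  then show ?case by (cases p) auto
qed simp

lemma cas_consecutive: "cas u p v \<Longrightarrow> Suc i < length p \<Longrightarrow> head G (p ! i) = tail G (p ! Suc i)"
proof (induction p arbitrary: u i)
  case (Cons e p)
  then show ?case using cas_ends[of "head G e" p v] by (cases i) auto
qed simp

end

text \<open>A connected graph has at least as many edges as a spanning tree: every vertex other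
  than \<open>r\<close> is assigned an edge leading to a vertex closer to
  \<open>r\<close>.\<close>

lemma card_vertices_le_edges:
  assumes F: "finite F" and V: "r \<in> V" "\<And>v. v \<in> V \<Longrightarrow> (r, v) \<in> R\<^sup>*"
    and ends: "\<And>u v. (u, v) \<in> R \<Longrightarrow> \<exists>e\<in>F. ends e = {u, v}"
  shows "card V \<le> card F + 1"
proof -
  define dist where "dist v = (LEAST k. (r, v) \<in> R ^^ k)" for v
  have "\<exists>e\<in>F. \<exists>u. ends e = {u, v} \<and> dist u < dist v" if "v \<in> V - {r}" for v
  proof -
    have "\<exists>k. (r, v) \<in> R ^^ k" using V that by (simp add: rtrancl_power)
    then have reach: "(r, v) \<in> R ^^ dist v" unfolding dist_def by (rule LeastI_ex)
    have "dist v \<noteq> 0"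
    proof
      assume "dist v = 0"
      then show False using reach that by simp
    qed
    then obtain k where k: "dist v = Suc k" by (cases "dist v") auto
    then obtain u where u: "(r, u) \<in> R ^^ k" "(u, v) \<in> R" using reach by auto
    then have "dist u \<le> k" unfolding dist_def by (intro Least_le)
    then show ?thesis using ends[OF u(2)] k by force
  qed
  then obtain f where f: "\<And>v. v \<in> V - {r} \<Longrightarrow> f v \<in> F \<and> (\<exists>u. ends (f v) = {u, v} \<and> dist u < dist v)"
    by metis
  have "inj_on f (V - {r})"
  proof (rule inj_onI)
    fix v w assume vw: "v \<in> V - {r}" "w \<in> V - {r}" "f v = f w"
    obtain x y where "ends (f v) = {x, v}" "dist x < dist v" "ends (f v) = {y, w}" "dist y < dist w"
      using f[OF vw(1)] f[OF vw(2)] vw(3) by auto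
    then show "v = w" by (auto simp: doubleton_eq_iff)
  qed
  then have "card (V - {r}) \<le> card F" using f F by (intro card_inj_on_le) auto
  then show ?thesis using V(1) by (simp add: card_Diff_singleton_if)
qed

context scheme
begin

text \<open>The offset flags of the edges of the cycle are extended periodically to all integer
  indices, so that \<open>cyclic_offset_flags\<close> applies.\<close>

lemma offset_cycle_cases:
  assumes "offset_cycle s l p"
  obtains (loop) c where "loop_cycle c" "p = [edge_of s c]"
  | (two) c0 c1 where "two_cycle c0 c1" "p = [edge_of s c0, edge_of s c1] \<or> p = [edge_of s c1, edge_of s c0]"
proof -
  let ?G = "offset_graph s l"
  interpret G: pre_digraph ?G .
  obtain u where u: "G.awalk u p u" "distinct (tl (G.awalk_verts u p))" "p \<noteq> []"
    using assms by (auto simp: offset_cycle_def G.cycle_def)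
  then have cas: "G.cas u p u" and arcs: "set p \<subseteq> arcs ?G" by (auto simp: G.awalk_def)
  have dist: "distinct (map (head ?G) p)" using u G.tl_awalk_verts[OF cas] by simp
  define k where "k = int (length p)"
  have k: "k > 0" using u by (simp add: k_def)
  define F where "F e = (SOME c. offset_flag c \<and> e = edge_of s c)" for e
  have F: "offset_flag (F e) \<and> e = edge_of s (F e)" if "e \<in> set p" for e
  proof -
    have "\<exists>c. offset_flag c \<and> e = edge_of s c" using arcs that offset_arcs by blast
    then show ?thesis unfolding F_def by (rule someI_ex)
  qed
  define pos where "pos j = nat (j mod k)" for j
  have pos: "pos j < length p" for j
    using k by (simp add: pos_def k_def nat_less_iff)
  have pos_Suc: "pos (j + 1) = (if Suc (pos j) < length p then Suc (pos j) else 0)" for j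
  proof -
    have "(j + 1) mod k = (j mod k + 1) mod k" by (simp add: mod_add_left_eq)
    moreover have b: "0 \<le> j mod k" "j mod k < k" using k by auto
    ultimately have "(j + 1) mod k = (if j mod k + 1 < k then j mod k + 1 else 0)"
      by (auto simp: mod_pos_pos_trivial)
        (smt (verit) mod_self)
    then show ?thesis using b by (auto simp: pos_def k_def nat_add_distrib)
  qed
  define c where "c j = F (p ! pos j)" for j
  have c: "offset_flag (c j)" "p ! pos j = edge_of s (c j)" for j
    using F[of "p ! pos j"] pos by (auto simp: c_def)
  have hd: "head ?G (p ! pos j) = vx (mate (c j))" and tl: "tail ?G (p ! pos j) = vx (c j)" for j
    using c offset_head offset_tail by simp_all
  have adj: "vx (mate (c j)) = vx (c (j + 1))" for j
  proof (cases "Suc (pos j) < length p")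
    case True
    then have "head ?G (p ! pos j) = tail ?G (p ! pos (j + 1))"
      using G.cas_consecutive[OF cas] pos_Suc[of j] by simp
    then show ?thesis by (simp add: hd tl)
  next
    case False
    then have "pos j = length p - 1" using pos[of j] by simp
    then have "head ?G (p ! pos j) = tail ?G (p ! pos (j + 1))"
      using G.cas_ends[OF cas u(3)] pos_Suc[of j] False by simp
    then show ?thesis by (simp add: hd tl)
  qed
  have "k = 1 \<and> loop_cycle (c 0) \<or> k = 2 \<and> (two_cycle (c 0) (c 1) \<or> two_cycle (c 1) (c 0))"
  proof (rule cyclic_offset_flags)
    show "k > 0" "offset_flag (c j)" "vx (mate (c j)) = vx (c (j + 1))" for j by (fact k c(1) adj)+
    show "c (j + k) = c j" for j by (simp add: c_def pos_def)
    fix i j assume "vx (c i) = vx (c j)"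
    then have "vx (mate (c (i - 1))) = vx (mate (c (j - 1)))"
      using adj[of "i - 1"] adj[of "j - 1"] by simp
    then have "map (head ?G) p ! pos (i - 1) = map (head ?G) p ! pos (j - 1)"
      using pos by (simp add: hd)
    then have "pos (i - 1) = pos (j - 1)" using dist pos by (metis length_map nth_eq_iff_index_eq)
    then have "(i - 1) mod k = (j - 1) mod k" using k by (simp add: pos_def nat_eq_iff)
    then show "k dvd i - j" by (simp add: mod_eq_dvd_iff)
  qed
  moreover have "p = [edge_of s (c 0)]" if "k = 1"
    using that c(2)[of 0] by (cases p) (auto simp: k_def pos_def)
  moreover have "p = [edge_of s (c 0), edge_of s (c 1)]" if "k = 2"
  proof -
    have "length p = Suc (Suc 0)" using that by (simp add: k_def)
    then obtain e f where p: "p = [e, f]" by (auto simp: length_Suc_conv)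
    moreover have "pos 0 = 0" "pos 1 = 1" using that by (auto simp: pos_def)
    ultimately show ?thesis using c(2)[of 0] c(2)[of 1] by simp
  qed
  ultimately show ?thesis using loop two by blast
qed

lemma vt_os: "c \<in> C \<Longrightarrow> vt (os c) = vt (\<sigma> c)"
  by (simp add: other_side_def)

lemma vt_theta_edge: "c \<in> E \<Longrightarrow> c \<in> T \<Longrightarrow> theta s c \<in> T \<and> vt (theta s c) = vt c + 1"
  using vt_theta[of c] by (cases "c = \<rho>") auto

lemma tour_at_Suc_vt: "c \<in> T \<Longrightarrow> tour_at (Suc (vt c)) = theta s c"
  by (simp add: tour_at_Suc vt_T)

lemma edge_of_mate [simp]: "c \<in> E \<Longrightarrow> edge_of s (mate c) = edge_of s c"
  and edge_of_os [simp]: "c \<in> E \<Longrightarrow> edge_of s (os c) = edge_of s c"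
  by (rule edge_of_cong; simp add: edge_of_eq)+

text \<open>The tour traverses the edge of \<open>c1\<close>, crosses the early bud, and traverses
  the edge of \<open>c0\<close>. It thus leaves the vertex of \<open>c0\<close> and comes back to
  it.\<close>

lemma two_cycle_first_pass:
  assumes "two_cycle c0 c1"
  shows "theta s (mate c1) = rv c1" "rv c1 \<notin> E" "theta s (rv c1) = mate c0"
    "vt (mate c0) = vt (mate c1) + 2"
proof -
  have E: "c0 \<in> E" "c1 \<in> E" and C: "c0 \<in> C" "c1 \<in> C"
    and bud: "rv c1 \<in> buds s" "rv c1 \<in> T" "mate c0 \<in> T" "vt (mate c0) = vt c1 + 1"
    using assms by (auto simp: two_cycle_def offset_flag_def early_bud_def)
  show th: "theta s (mate c1) = rv c1" using E by (simp add: theta_E)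
  show "rv c1 \<notin> E" using bud by (simp add: edge_corners_def)
  have "vt (rv c1) = vt (mate c1) + 1"
    using vt_theta_edge[of "mate c1"] two_cycle_T[OF assms] E th by simp
  then show "vt (mate c0) = vt (mate c1) + 2" using bud C by simp
  have "theta s (rv c1) = tour_at (Suc (vt (rv c1)))" using tour_at_Suc_vt bud by simp
  also have "\<dots> = mate c0" using bud C vt_T(3)[OF bud(3)] by simp
  finally show "theta s (rv c1) = mate c0" .
qed

text \<open>Later, the tour traverses the edge of \<open>c0\<close>, crosses the late bud, and
  traverses the edge of \<open>c1\<close>. It thus leaves the vertex of \<open>c1\<close> and
  comes back to it.\<close>

lemma two_cycle_second_pass:
  assumes "two_cycle c0 c1"
  shows "theta s (os (mate c0)) = \<sigma> c0" "\<sigma> c0 \<notin> E" "theta s (\<sigma> c0) = os (mate c1)"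
    "vt (os (mate c1)) = vt (os (mate c0)) + 2"
proof -
  have E: "c0 \<in> E" "c1 \<in> E" and C: "c0 \<in> C" "c1 \<in> C" "mate c0 \<in> C" "mate c1 \<in> C"
    and bud: "\<sigma> c0 \<in> buds s" "\<sigma> c0 \<in> T" "os (mate c1) \<in> T" "vt (\<sigma> (mate c1)) = vt (\<sigma> c0) + 1"
    using assms by (auto simp: two_cycle_def offset_flag_def late_bud_def)
  have osE: "os (mate c0) \<in> E" using E C by simp
  show th: "theta s (os (mate c0)) = \<sigma> c0" using E C osE mate_os[of "mate c0"] by (simp add: theta_E)
  show "\<sigma> c0 \<notin> E" using bud by (simp add: edge_corners_def)
  have "vt (\<sigma> c0) = vt (os (mate c0)) + 1"
    using vt_theta_edge[OF osE] two_cycle_T[OF assms] th by simp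
  then show "vt (os (mate c1)) = vt (os (mate c0)) + 2" using bud vt_os[OF C(4)] by simp
  have "theta s (\<sigma> c0) = tour_at (Suc (vt (\<sigma> c0)))" using tour_at_Suc_vt bud by simp
  also have "\<dots> = os (mate c1)" using bud vt_T(3)[OF bud(3)] vt_os[OF C(4)] by simp
  finally show "theta s (\<sigma> c0) = os (mate c1)" .
qed

lemma sublist_tour_edges:
  assumes x: "x \<in> T" "x \<in> E" and y: "theta s x \<notin> E" and z: "theta s (theta s x) \<in> E" "theta s (theta s x) \<in> T"
    and t: "vt (theta s (theta s x)) = vt x + 2"
  shows "sublist [edge_of s x, edge_of s (theta s (theta s x))] (tour_edges s)"
proof -
  define i where "i = vt x"
  have i: "1 \<le> i" "i + 2 \<le> tour_len" "tour_at i = x" using vt_T[OF x(1)] vt_T(2)[OF z(2)] t by (auto simp: i_def)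
  have s: "tour_at (i + 1) = theta s x" "tour_at (i + 2) = theta s (theta s x)" using i(3) by (simp_all add: tour_at_Suc)
  have "[1..<Suc tour_len] = [1..<i] @ [i..<i + 3] @ [i + 3..<Suc tour_len]"
    using i upt_add_eq_append[of 1 i "Suc tour_len - i"] upt_add_eq_append[of i "i + 3" "tour_len - (i + 2)"] by simp
  also have "[i..<i + 3] = [i, i + 1, i + 2]" by (simp add: upt_rec)
  finally have "tour s = map tour_at [1..<i] @ [x, theta s x, theta s (theta s x)] @ map tour_at [i + 3..<Suc tour_len]"
    using i s by (simp add: tour_def tour_len_def tour_at_def[abs_def])
  then have "tour_edges s = map (edge_of s) (filter (\<lambda>c. c \<in> E) (map tour_at [1..<i])) @
      [edge_of s x, edge_of s (theta s (theta s x))] @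
      map (edge_of s) (filter (\<lambda>c. c \<in> E) (map tour_at [i + 3..<Suc tour_len]))"
    using x y z by (simp add: tour_edges_def)
  then show ?thesis by (auto simp: sublist_def)
qed

lemma two_cycle_sublists:
  assumes "two_cycle c0 c1"
  shows "sublist [edge_of s c1, edge_of s c0] (tour_edges s)"
    "sublist [edge_of s c0, edge_of s c1] (tour_edges s)"
proof -
  have E: "c0 \<in> E" "c1 \<in> E" and C: "mate c0 \<in> C" "mate c1 \<in> C"
    using assms by (auto simp: two_cycle_def offset_flag_def)
  then have osE: "os (mate c0) \<in> E" "os (mate c1) \<in> E" by auto
  note T = two_cycle_T[OF assms]
  show "sublist [edge_of s c1, edge_of s c0] (tour_edges s)"
    using sublist_tour_edges[of "mate c1"] two_cycle_first_pass[OF assms] E T by simp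
  show "sublist [edge_of s c0, edge_of s c1] (tour_edges s)"
    using sublist_tour_edges[of "os (mate c0)"] two_cycle_second_pass[OF assms] E T C osE by simp
qed

lemma forward_edgeI:
  assumes "c \<in> E" "mate c \<in> T" "os (mate c) \<in> T"
  shows "forward_edge s (edge_of s c)"
  unfolding forward_edge_def using assms by (intro bexI[of _ "mate c"]) auto

lemma loop_sublist: assumes "loop_cycle c" shows "sublist [edge_of s c] (tour_edges s)"
proof -
  have "c \<in> E" "mate c \<in> T" using assms by (auto simp: loop_cycle_def offset_flag_def)
  then have "edge_of s (mate c) \<in> set (tour_edges s)"
    unfolding tour_edges_def by (auto simp del: edge_of_mate)
  then obtain xs ys where "tour_edges s = xs @ edge_of s (mate c) # ys" by (meson split_list)
  then show ?thesis using \<open>c \<in> E\<close> by (auto simp: sublist_def)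
qed

lemma offset_cycle_forward:
  assumes "offset_cycle s l p"
  shows "length p \<le> 2" "\<forall>e\<in>set p. forward_edge s e" "sublist p (tour_edges s)"
proof -
  show "length p \<le> 2" using assms by (rule offset_cycle_cases) auto
  show "sublist p (tour_edges s)"
    using assms by (rule offset_cycle_cases) (auto simp: loop_sublist two_cycle_sublists)
  show "\<forall>e\<in>set p. forward_edge s e"
    using assms
  proof (rule offset_cycle_cases)
    fix c assume "loop_cycle c" "p = [edge_of s c]"
    then show ?thesis by (auto simp: loop_cycle_def offset_flag_def intro: forward_edgeI)
  next
    fix c0 c1 assume two: "two_cycle c0 c1"
      and p: "p = [edge_of s c0, edge_of s c1] \<or> p = [edge_of s c1, edge_of s c0]"
    have "c0 \<in> E" "c1 \<in> E" using two by (auto simp: two_cycle_def offset_flag_def)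
    then show ?thesis using two_cycle_T[OF two] p by (auto intro: forward_edgeI)
  qed
qed

text \<open>The two sides of a forward edge are followed in the same direction. A consistent
  choice of rotation directions contains all corners of the tour or none, and cannot contain both
  or neither of \<open>x\<close> and \<open>os x\<close>, which turn in opposite directions at the
  same vertex.\<close>

lemma orientable_no_forward_edge:
  assumes "orientable s" "x \<in> E" "x \<in> T"
  shows "os x \<notin> T"
proof -
  obtain P where P: "\<And>c. c \<in> C \<Longrightarrow> c \<in> P \<longleftrightarrow> rv c \<notin> P" "\<And>c. c \<in> P \<Longrightarrow> \<sigma> c \<in> P \<and> theta s c \<in> P"
    "P \<subseteq> C"
    using assms(1) unfolding orientable_def by blast
  have invariant: "f c \<in> P \<longleftrightarrow> c \<in> P" if c: "c \<in> C" and "f = \<sigma> \<or> f = theta s" for c f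
  proof
    assume "f c \<in> P"
    have fC: "f c \<in> C" "f (rv (f c)) = rv c" using that theta_rv_theta by auto
    show "c \<in> P"
    proof (rule ccontr)
      assume "c \<notin> P"
      then have "rv c \<in> P" using P(1) c by blast
      have f: "f x \<in> P" if "x \<in> P" for x using that P(2) \<open>f = \<sigma> \<or> f = theta s\<close> by blast
      have inj: "inj_on f C" using \<open>f = \<sigma> \<or> f = theta s\<close> inj_sg inj_theta by blast
      have "f ` P = P"
      proof (rule endo_inj_surj)
        show "finite P" using P(3) finite_C finite_subset by blast
        show "inj_on f P" using inj P(3) inj_on_subset by blast
      qed (use f in blast)
      then obtain y where y: "y \<in> P" "f y = f c" using \<open>f c \<in> P\<close> by (metis imageE)
      then have "y = c" using inj P(3) c by (meson inj_onD subsetD)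
      then show False using y \<open>c \<notin> P\<close> by simp
    qed
  qed (use P(2) that in blast)
  have tour: "tour_at k \<in> P \<longleftrightarrow> \<rho> \<in> P" for k
    by (induction k) (simp_all add: tour_at_Suc invariant, simp add: tour_at_def)
  show ?thesis
  proof
    assume "os x \<in> T"
    then have "x \<in> P \<longleftrightarrow> os x \<in> P" using assms(3) tour by (auto simp: tour_range)
    moreover have "os x \<in> P \<longleftrightarrow> \<sigma> x \<notin> P"
      using P(1)[of "os x"] assms(2) by simp
    moreover have "\<sigma> x \<in> P \<longleftrightarrow> x \<in> P" using invariant[of x \<sigma>] assms(2) by simp
    ultimately show False by blast
  qed
qed

lemma orientable_no_offset_cycle:
  assumes "orientable s" shows "\<not> offset_cycle s l p"
proof
  assume p: "offset_cycle s l p"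
  have "p \<noteq> []" using p by (rule offset_cycle_cases) auto
  then obtain e where "e \<in> set p" by (meson hd_in_set)
  then have "forward_edge s e" using offset_cycle_forward(2)[OF p] by blast
  then show False using orientable_no_forward_edge[OF assms] by (auto simp: forward_edge_def)
qed

section \<open>Disjointness of the offset cycles\<close>

text \<open>Since a cycle has length at most 2, it consists of the edges by which it enters and
  leaves any one of its vertices.\<close>

lemma offset_cycle_at_vertex:
  assumes p: "offset_cycle s l p" and v: "v \<in> cycle_vertices s l p"
  obtains a c where "offset_flag a" "offset_flag c" "vx (mate a) = v" "vx c = v"
    "mate a \<in> T" "\<sigma> c \<in> T" "set p = {edge_of s a, edge_of s c}"
    "vx a \<in> cycle_vertices s l p" "vx (mate c) \<in> cycle_vertices s l p"
    "vx a = vx (mate a) \<or> vx c = vx (mate c) \<longrightarrow> a = c"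
proof -
  have sg: "\<sigma> c \<in> T" if "c \<in> E" "os (mate c) \<in> T" for c
  proof -
    have "mate (os c) \<in> T" using that by (simp add: mate_os)
    then have "os c \<notin> T" using mate_T[of "os c"] that by simp
    then show ?thesis using rv_T[of "os c"] that by simp
  qed
  from p show ?thesis
  proof (cases rule: offset_cycle_cases)
    case (loop c)
    then have c: "offset_flag c" "vx (mate c) = vx c" "mate c \<in> T" "os (mate c) \<in> T"
      by (auto simp: loop_cycle_def)
    have verts: "cycle_vertices s l p = {vx c}"
      using loop(2) offset_tail[OF c(1)] by (simp add: cycle_vertices_def)
    show ?thesis
    proof (rule that[of c c])
      show "\<sigma> c \<in> T" using sg c offset_flag_E by blast
      show "vx (mate c) = v" "vx c = v" using verts v c by auto
    qed (use c verts loop(2) in auto)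
  next
    case (two c0 c1)
    have f: "offset_flag c0" "offset_flag c1" using two by (auto simp: two_cycle_def)
    have set: "set p = {edge_of s c0, edge_of s c1}" using two by auto
    then have verts: "cycle_vertices s l p = {vx c0, vx c1}"
      using f by (auto simp: cycle_vertices_def offset_tail)
    note T = two_cycle_T[OF two(1)]
    have sgT: "\<sigma> c0 \<in> T" "\<sigma> c1 \<in> T" using T sg f offset_flag_E by blast+
    have ends: "vx (mate c0) = vx c1" "vx (mate c1) = vx c0" "vx c0 \<noteq> vx c1"
      using two by (auto simp: two_cycle_def)
    show ?thesis
    proof (cases "v = vx c0")
      case True
      show ?thesis
        by (rule that[of c1 c0]) (use f set verts T sgT ends True in auto)
    next
      case False
      then have "v = vx c1" using v verts by auto
      show ?thesis
        by (rule that[of c0 c1]) (use f set verts T sgT ends \<open>v = vx c1\<close> in auto)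
    qed
  qed
qed

lemma ordinary_or_eq: "vx c \<noteq> vx d \<Longrightarrow> ordinary c \<or> ordinary d"
  using vx_eq by blast

text \<open>At an ordinary common vertex, both cycles have the same incoming and outgoing edges by
  \<open>passage_unique\<close>. At the virtual root vertex this holds for one of the two edges;
  its other end is then an ordinary vertex common to both cycles, unless the edge is a loop and
  hence the whole of both cycles.\<close>

lemma offset_cycles_disjoint:
  assumes p: "offset_cycle s l p" and q: "offset_cycle s l q"
    and v: "v \<in> cycle_vertices s l p" "v \<in> cycle_vertices s l q"
  shows "set p = set q"
proof -
  have flags: "a = a' \<or> c = c'" "ordinary c \<Longrightarrow> a = a' \<and> c = c'"
    if f: "offset_flag a" "offset_flag c" "vx (mate a) = v" "vx c = v" "mate a \<in> T" "\<sigma> c \<in> T"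
      "offset_flag a'" "offset_flag c'" "vx (mate a') = v" "vx c' = v" "mate a' \<in> T" "\<sigma> c' \<in> T"
    for a c a' c' v
  proof -
    have P: "passage (mate a) c" "passage (mate a') c'"
      using f by (auto intro: passage_offset_flags)
    have eq: "mate a = mate a' \<Longrightarrow> a = a'" using f offset_flag_E by (metis mate_mate)
    have vx: "vx (mate a) = vx (mate a')" using f by simp
    show "a = a' \<or> c = c'" using passage_unique(1)[OF P vx] f eq by blast
    show "a = a' \<and> c = c'" if "ordinary c"
    proof -
      have "ordinary (mate a)" using that f by simp
      then show ?thesis using passage_unique(2)[OF P vx] f eq by blast
    qed
  qed
  have ordinary: "set p = set q"
    if "v \<in> cycle_vertices s l p" "v \<in> cycle_vertices s l q" "\<not> (virtually_rooted s \<and> \<rho> \<in> v)" for v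
  proof -
    obtain a c where P: "offset_flag a" "offset_flag c" "vx (mate a) = v" "vx c = v"
      "mate a \<in> T" "\<sigma> c \<in> T" "set p = {edge_of s a, edge_of s c}"
      "vx a \<in> cycle_vertices s l p" "vx (mate c) \<in> cycle_vertices s l p"
      "vx a = vx (mate a) \<or> vx c = vx (mate c) \<longrightarrow> a = c"
      by (rule offset_cycle_at_vertex[OF p \<open>v \<in> cycle_vertices s l p\<close>])
    obtain a' c' where Q: "offset_flag a'" "offset_flag c'" "vx (mate a') = v" "vx c' = v"
      "mate a' \<in> T" "\<sigma> c' \<in> T" "set q = {edge_of s a', edge_of s c'}"
      "vx a' \<in> cycle_vertices s l q" "vx (mate c') \<in> cycle_vertices s l q"
      "vx a' = vx (mate a') \<or> vx c' = vx (mate c') \<longrightarrow> a' = c'"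
      by (rule offset_cycle_at_vertex[OF q \<open>v \<in> cycle_vertices s l q\<close>])
    have "ordinary c" using that(3) P(4) by simp
    then have "a = a' \<and> c = c'" using flags(2)[OF P(1-6) Q(1-6)] by simp
    then show ?thesis using P(7) Q(7) by simp
  qed
  obtain a c where P: "offset_flag a" "offset_flag c" "vx (mate a) = v" "vx c = v"
    "mate a \<in> T" "\<sigma> c \<in> T" "set p = {edge_of s a, edge_of s c}"
    "vx a \<in> cycle_vertices s l p" "vx (mate c) \<in> cycle_vertices s l p"
    "vx a = vx (mate a) \<or> vx c = vx (mate c) \<longrightarrow> a = c"
    by (rule offset_cycle_at_vertex[OF p v(1)])
  obtain a' c' where Q: "offset_flag a'" "offset_flag c'" "vx (mate a') = v" "vx c' = v"
    "mate a' \<in> T" "\<sigma> c' \<in> T" "set q = {edge_of s a', edge_of s c'}"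
    "vx a' \<in> cycle_vertices s l q" "vx (mate c') \<in> cycle_vertices s l q"
    "vx a' = vx (mate a') \<or> vx c' = vx (mate c') \<longrightarrow> a' = c'"
    by (rule offset_cycle_at_vertex[OF q v(2)])
  have other: "set p = set q"
    if "virtually_rooted s" "\<rho> \<in> v" "w \<in> cycle_vertices s l p" "w \<in> cycle_vertices s l q" "w \<noteq> v" "w = vx x" for w x
  proof -
    have "\<rho> \<notin> w" using that vx_eq[of \<rho> x] vx_eq[of \<rho> c] P(4) by metis
    then show ?thesis using ordinary that by blast
  qed
  show ?thesis
  proof (cases "virtually_rooted s \<and> \<rho> \<in> v")
    case False
    then show ?thesis using ordinary v by blast
  next
    case True
    consider "a = a'" | "c = c'" using flags(1)[OF P(1-6) Q(1-6)] by blast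
    then show ?thesis
    proof cases
      case 1
      show ?thesis
      proof (cases "vx a = v")
        case True
        then show ?thesis using 1 P Q by auto
      next
        case False
        then show ?thesis using other[of "vx a" a] \<open>virtually_rooted s \<and> \<rho> \<in> v\<close> P Q 1 by auto
      qed
    next
      case 2
      show ?thesis
      proof (cases "vx (mate c) = v")
        case True
        then show ?thesis using 2 P Q by auto
      next
        case False
        then show ?thesis using other[of "vx (mate c)" "mate c"] \<open>virtually_rooted s \<and> \<rho> \<in> v\<close> P Q 2 by auto
      qed
    qed
  qed
qed

section \<open>The total length of the offset cycles\<close>

definition cycle_edges :: "'a set set" where
  "cycle_edges = \<Union>{set p |p. offset_cycle s l p}"

lemma total_cycle_length_eq: "total_cycle_length s l = card cycle_edges"
proof -
  let ?S = "{set p |p. offset_cycle s l p}"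
  have "pairwise disjnt ?S"
  proof (rule pairwiseI)
    fix A B assume "A \<in> ?S" "B \<in> ?S" "A \<noteq> B"
    then obtain p q where pq: "offset_cycle s l p" "offset_cycle s l q" "A = set p" "B = set q" by blast
    show "disjnt A B"
    proof (rule ccontr)
      assume "\<not> disjnt A B"
      then obtain e where "e \<in> set p" "e \<in> set q" using pq by (auto simp: disjnt_def)
      then have "tail (offset_graph s l) e \<in> cycle_vertices s l p" "tail (offset_graph s l) e \<in> cycle_vertices s l q"
        by (auto simp: cycle_vertices_def)
      then show False using offset_cycles_disjoint pq \<open>A \<noteq> B\<close> by blast
    qed
  qed
  then show ?thesis
    unfolding total_cycle_length_def cycle_edges_def by (subst card_Union_disjoint) auto
qed

text \<open>The vertices of \<open>c0\<close> and \<open>c1\<close> would both have an early bud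
  with respect to one of the cycles and a late bud with respect to the other. One of the two
  vertices is ordinary, and there both cycles make the same passage, which cannot involve an early
  and a late bud at once.\<close>

lemma two_cycles_no_chain:
  assumes "two_cycle c0 c1" "two_cycle c1 c2"
  shows False
proof -
  have f: "offset_flag c0" "offset_flag c1" "offset_flag c2" "vx (mate c0) = vx c1" "vx (mate c1) = vx c0"
    "vx (mate c2) = vx c1" "vx (mate c1) = vx c2" "vx c0 \<noteq> vx c1"
    and bud: "early_bud (mate c0) c1" "late_bud (mate c1) c0" "early_bud (mate c1) c2" "late_bud (mate c2) c1"
    using assms by (auto simp: two_cycle_def)
  have P: "passage (mate c0) c1" "passage (mate c2) c1" "passage (mate c1) c0" "passage (mate c1) c2"
    using f by (auto intro: passage_offset_flags)
  have T: "mate c0 \<in> T" "mate c1 \<in> T" "mate c2 \<in> T" "\<sigma> c0 \<in> T" "\<sigma> c1 \<in> T"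
    using two_cycle_T[OF assms(1)] two_cycle_T[OF assms(2)] bud by (auto simp: late_bud_def)
  have "\<not> ordinary c1"
  proof
    assume "ordinary c1"
    then have "ordinary (mate c0)" using f(4) by simp
    then have "mate c0 = mate c2"
      using passage_unique(2)[OF P(1,2) _ T(1,3,5,5)] f by simp
    then show False using bud(1,4) passage_cases[OF P(1)] by simp
  qed
  moreover have "\<not> ordinary c0"
  proof
    assume "ordinary c0"
    then have "ordinary (mate c1)" using f(5) by simp
    moreover have "\<sigma> c2 \<in> T"
    proof -
      have c2: "c2 \<in> E" using f(3) offset_flag_E by blast
      have "mate (os c2) \<in> T" using two_cycle_T(4)[OF assms(2)] c2 by (simp add: mate_os)
      then have "os c2 \<notin> T" using mate_T[of "os c2"] c2 by simp
      then show ?thesis using rv_T[of "os c2"] c2 by simp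
    qed
    ultimately have "c0 = c2"
      using passage_unique(2)[OF P(3,4) _ T(2,2,4)] by simp
    then show False using bud(2,3) passage_cases[OF P(3)] by simp
  qed
  ultimately show False using ordinary_or_eq[OF f(8)] by blast
qed

definition kept_adj :: "('a set \<times> 'a set) set" where
  "kept_adj = {(vx c, vx (mate c)) |c. c \<in> E \<and> edge_of s c \<notin> cycle_edges}"

text \<open>As cycle edges are forward, the tour enters them at one known end only.\<close>

lemma cycle_edge_cases:
  assumes x: "x \<in> E" "x \<in> T" "edge_of s x \<in> cycle_edges"
  obtains (loop) "vx (mate x) = vx x"
  | (two) c0 c1 where "two_cycle c0 c1" "edge_of s c0 \<in> cycle_edges" "edge_of s c1 \<in> cycle_edges"
      "x \<in> {mate c0, os (mate c0), mate c1, os (mate c1)}"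
proof -
  obtain p where p: "offset_cycle s l p" "edge_of s x \<in> set p" using x by (auto simp: cycle_edges_def)
  have pD: "set p \<subseteq> cycle_edges" using p by (auto simp: cycle_edges_def)
  have side: "x \<in> {mate c, os (mate c)}" if "edge_of s x = edge_of s c" "c \<in> E" "mate c \<in> T" "os (mate c) \<in> T" for c
  proof -
    have "c \<notin> T" "os c \<notin> T" using that mate_T[of c] mate_T[of "os c"] by (auto simp: mate_os)
    moreover have "x \<in> edge_of s c" using that(1) by (metis edge_of_eq insertI1)
    ultimately show ?thesis using x by (auto simp: edge_of_eq)
  qed
  from p(1) show ?thesis
  proof (cases rule: offset_cycle_cases)
    case (loop c)
    then have c: "c \<in> E" "vx (mate c) = vx c" "mate c \<in> T" "os (mate c) \<in> T" "edge_of s x = edge_of s c"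
      using p by (auto simp: loop_cycle_def offset_flag_E)
    then have "x = mate c \<or> x = os (mate c)" using side by blast
    then show ?thesis using c that(1) mate_os[of "mate c"] by auto
  next
    case (two c0 c1)
    have "edge_of s x = edge_of s c0 \<or> edge_of s x = edge_of s c1" using two p by auto
    moreover have "c0 \<in> E" "c1 \<in> E" using two by (auto simp: two_cycle_def offset_flag_E)
    ultimately have "x \<in> {mate c0, os (mate c0), mate c1, os (mate c1)}"
      using side[of c0] side[of c1] two_cycle_T[OF two(1)] by blast
    moreover have "edge_of s c0 \<in> cycle_edges" "edge_of s c1 \<in> cycle_edges" using pD two by auto
    ultimately show ?thesis using that(2) two(1) by blast
  qed
qed

text \<open>Each pass of the tour through a cycle of length 2 visits one vertex and returns to
  where it came from. The corners visited between the two edges in the first pass form a detour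
  from the vertex of \<open>c0\<close>.\<close>

definition detour :: "'a \<Rightarrow> bool" where
  "detour x \<longleftrightarrow> (\<exists>c0 c1. two_cycle c0 c1 \<and> edge_of s c0 \<in> cycle_edges \<and> edge_of s c1 \<in> cycle_edges \<and>
     (x = rv c1 \<or> x = mate c0))"

text \<open>The tour is followed in the graph without cycle edges. Loops are skipped. After a pass
  through a cycle of length 2 the tour is back at a vertex visited before, from which the walk can
  resume; only the detours of first passes are lost. In a second pass the vertex of
  \<open>c0\<close> has already been reached before the first pass, so nothing is lost.\<close>

lemma tour_connected:
  assumes "1 \<le> t" "t \<le> tour_len"
  shows "(vx (tour_at 1), vx (tour_at t)) \<in> kept_adj\<^sup>* \<or> detour (tour_at t)"
  using assms
proof (induction t rule: less_induct)
  case (less t)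
  let ?K = "{u. (vx (tour_at 1), u) \<in> kept_adj\<^sup>*}"
  show ?case
  proof (cases "t = 1")
    case False
    define x where "x = tour_at (t - 1)"
    have t1: "1 \<le> t - 1" "t - 1 < t" "t - 1 \<le> tour_len" using False less.prems by auto
    have next_x: "tour_at t = theta s x" using t1 tour_at_Suc[of "t - 1"] by (simp add: x_def)
    have xT: "x \<in> T" using t1 by (auto simp: x_def tour_set)
    then have xC: "x \<in> C" by (rule tour_C)
    have vt_x: "vt x = t - 1" using vt_tour_at t1 by (simp add: x_def)
    have IH: "vx x \<in> ?K \<or> detour x" using less.IH[of "t - 1"] t1 by (simp add: x_def)
    have earlier: "vx y \<in> ?K \<or> detour y" if "y \<in> T" "vt y < t" for y
      using less.IH[of "vt y"] that vt_T[OF that(1)] less.prems by auto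
    have goalI: "vx (theta s x) \<in> ?K \<Longrightarrow> ?thesis" and goalI': "detour (theta s x) \<Longrightarrow> ?thesis"
      using next_x by auto
    show ?thesis
    proof (cases "x \<in> E")
      case False
      from IH show ?thesis
      proof
        assume "vx x \<in> ?K"
        then show ?thesis using vx_theta_stem[OF xC False] by (intro goalI) simp
      next
        assume "detour x"
        then obtain c0 c1 where two: "two_cycle c0 c1" "edge_of s c0 \<in> cycle_edges"
          "edge_of s c1 \<in> cycle_edges" and x: "x = rv c1 \<or> x = mate c0"
          by (auto simp: detour_def)
        have "c0 \<in> E" using two(1) by (auto simp: two_cycle_def offset_flag_E)
        then have "x = rv c1" using x False by auto
        then have "theta s x = mate c0" using two_cycle_first_pass(3)[OF two(1)] by simp
        then show ?thesis using two by (intro goalI') (auto simp: detour_def)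
      qed
    next
      case True
      have x_detour: "\<exists>c0 c1. two_cycle c0 c1 \<and> x = mate c0 \<and> edge_of s x \<in> cycle_edges" if d: "detour x"
      proof -
        obtain c0 c1 where two: "two_cycle c0 c1" "edge_of s c0 \<in> cycle_edges"
          "edge_of s c1 \<in> cycle_edges" and x: "x = rv c1 \<or> x = mate c0"
          using d by (auto simp: detour_def)
        then have "x = mate c0" using two_cycle_first_pass(2)[OF two(1)] True by auto
        moreover have "c0 \<in> E" using two(1) by (auto simp: two_cycle_def offset_flag_E)
        ultimately show ?thesis using two by auto
      qed
      show ?thesis
      proof (cases "edge_of s x \<in> cycle_edges")
        case False
        then have "vx x \<in> ?K" using IH x_detour by blast
        moreover have "(vx x, vx (mate x)) \<in> kept_adj" using True False by (auto simp: kept_adj_def)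
        ultimately show ?thesis using vx_theta_edge[OF True] by (intro goalI) auto
      next
        case cyc: True
        from True xT cyc show ?thesis
        proof (cases rule: cycle_edge_cases)
          case loop
          have "\<not> detour x"
          proof
            assume "detour x"
            then obtain c0 c1 where two: "two_cycle c0 c1" "x = mate c0" using x_detour by blast
            then have "c0 \<in> E" "vx (mate c0) \<noteq> vx c0" by (auto simp: two_cycle_def offset_flag_E)
            then show False using loop two by simp
          qed
          then show ?thesis using IH loop vx_theta_edge[OF True] by (intro goalI) simp
        next
          case (two c0 c1)
          have f: "offset_flag c0" "offset_flag c1" "vx (mate c0) = vx c1" "vx (mate c1) = vx c0"
            using two(1) by (auto simp: two_cycle_def)
          have E: "c0 \<in> E" "c1 \<in> E" "mate c0 \<in> E" using f offset_flag_E by auto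
          have C: "c0 \<in> C" "c1 \<in> C" "mate c0 \<in> C" "mate c1 \<in> C" using E by auto
          note T = two_cycle_T[OF two(1)]
          note first = two_cycle_first_pass[OF two(1)] and second = two_cycle_second_pass[OF two(1)]
          have not_d1: "\<not> detour (mate c1)"
          proof
            assume "detour (mate c1)"
            then obtain b0 b1 where b: "two_cycle b0 b1" "mate c1 = rv b1 \<or> mate c1 = mate b0"
              by (auto simp: detour_def)
            have "mate c1 \<in> E" using E by simp
            then have "mate c1 = mate b0" using b two_cycle_first_pass(2)[OF b(1)] by auto
            moreover have "b0 \<in> E" using b(1) by (auto simp: two_cycle_def offset_flag_E)
            ultimately have "b0 = c1" using E by (metis mate_mate)
            then show False using two_cycles_no_chain two(1) b(1) by blast
          qed
          have not_d2: "\<not> detour (os (mate c0))"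
          proof
            assume "detour (os (mate c0))"
            then obtain b0 b1 where b: "two_cycle b0 b1" "os (mate c0) = rv b1 \<or> os (mate c0) = mate b0"
              by (auto simp: detour_def)
            have "os (mate c0) \<in> E" using E C by simp
            then have m: "os (mate c0) = mate b0" using b two_cycle_first_pass(2)[OF b(1)] by auto
            have b0: "offset_flag b0" "b0 \<in> E" using b(1) by (auto simp: two_cycle_def offset_flag_E)
            have "edge_of s b0 = edge_of s c0" using m b0 E by (metis edge_of_mate edge_of_os)
            then have "b0 = c0" using offset_flag_unique b0 f by blast
            then show False using m C os_neq by metis
          qed
          have w: "vt (mate c1) < t \<Longrightarrow> vx c0 \<in> ?K" using earlier[OF T(3)] not_d1 f by simp
          have v: "vt (os (mate c0)) < t \<Longrightarrow> vx c1 \<in> ?K" using earlier[OF T(2)] not_d2 f C by simp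
          have order: "vt (mate c0) < vt (os (mate c0))"
            using drop_edge[OF E(3)] f(1) C vt_os by (simp add: offset_flag_def)
          from two(4) consider "x = mate c0" | "x = os (mate c0)" | "x = mate c1" | "x = os (mate c1)"
            by blast
          then show ?thesis
          proof cases
            case 1
            have "vt (mate c1) < t" using first(4) vt_x 1 t1 by simp
            then show ?thesis using w vx_theta_edge[OF True] 1 E by (intro goalI) simp
          next
            case 2
            have "vt (mate c1) < t" using first(4) order vt_x 2 t1 by simp
            then show ?thesis using w second(1) 2 C by (intro goalI) simp
          next
            case 3
            then show ?thesis using first(1) two by (intro goalI') (auto simp: detour_def)
          next
            case 4
            have "vt (os (mate c0)) < t" using second(4) vt_x 4 t1 by simp
            moreover have "vx (mate x) = vx c1" using 4 E C mate_os[of "mate c1"] by simp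
            ultimately show ?thesis using v vx_theta_edge[OF True] by (intro goalI) simp
          qed
        qed
      qed
    qed
  qed simp
qed

text \<open>The vertex of a detour has another corner, the one with relative label 0, that lies on
  no detour, since detours consist of corners with relative labels 1 and 2.\<close>

lemma all_vertices_connected:
  assumes "v \<in> vertices s" shows "(vx (tour_at 1), v) \<in> kept_adj\<^sup>*"
proof (rule ccontr)
  assume not: "(vx (tour_at 1), v) \<notin> kept_adj\<^sup>*"
  have detour: "detour y" if "y \<in> T" "vx y = v" for y
    using tour_connected[of "vt y"] vt_T[OF that(1)] that not by simp
  obtain y where "y \<in> C" "v = vx y" using assms by (auto simp: vertices_def)
  then have "y \<in> T \<or> rv y \<in> T" "vx (rv y) = v" by auto
  then obtain z where "z \<in> T" "vx z = v" using \<open>v = vx y\<close> by blast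
  then obtain c0 c1 where two: "two_cycle c0 c1" and z: "z = rv c1 \<or> z = mate c0"
    using detour[of z] by (auto simp: detour_def)
  have c: "offset_flag c1" "c1 \<in> E" "c1 \<in> C" "vx (mate c0) = vx c1"
    using two by (auto simp: two_cycle_def offset_flag_E)
  then have "vx z = vx c1" using z by (elim disjE) simp_all
  then have v: "vx c1 = v" using \<open>vx z = v\<close> by simp
  have "mate (os c1) \<in> T" using two_cycle_T(4)[OF two] c by (simp add: mate_os)
  then have "os c1 \<notin> T" using mate_T[of "os c1"] c by simp
  then have "\<sigma> c1 \<in> T" using rv_T[of "os c1"] c by simp
  then have "detour (\<sigma> c1)" using detour v c by simp
  then obtain b0 b1 where b: "two_cycle b0 b1" "\<sigma> c1 = rv b1 \<or> \<sigma> c1 = mate b0"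
    by (auto simp: detour_def)
  have f: "offset_flag b0" "offset_flag b1" "b1 \<in> C" "vx (mate b0) = vx b1"
    using b(1) by (auto simp: two_cycle_def offset_flag_E)
  have "vx (\<sigma> c1) = vx b1" using b(2) f(3,4) by (elim disjE) simp_all
  then have "vx b1 = vx c1" using c by simp
  then have "vertex_min b1 = vertex_min c1" "vertex_min (mate b0) = vertex_min c1" using f(4) by (auto intro: vertex_min_cong)
  moreover have "l (\<sigma> c1) = vertex_min c1" using c(1) by (simp add: offset_flag_def)
  moreover have "l (\<sigma> c1) = l b1 \<or> l (\<sigma> c1) = l (mate b0)"
    using b(2) f(3) by (elim disjE) simp_all
  moreover have "l b1 = vertex_min b1 + 1" "l (mate b0) = vertex_min (mate b0) + 2"
    using f(1,2) by (simp_all add: offset_flag_def)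
  ultimately show False by linarith
qed

text \<open>Twice the genus is the number of edges outside a spanning tree, and the graph
  without the cycle edges still contains a spanning tree.\<close>

lemma total_cycle_length_le_genus: "of_nat (total_cycle_length s l) \<le> 2 * genus s"
proof -
  have finE: "finite (edges s)" using finite_C by (simp add: edges_def edge_corners_def)
  have sub: "cycle_edges \<subseteq> edges s"
  proof
    fix e assume "e \<in> cycle_edges"
    then obtain p where "offset_cycle s l p" "e \<in> set p" by (auto simp: cycle_edges_def)
    then have "forward_edge s e" using offset_cycle_forward(2) by blast
    then show "e \<in> edges s" by (auto simp: forward_edge_def edges_def)
  qed
  have "card (vertices s) \<le> card (edges s - cycle_edges) + 1"
  proof (rule card_vertices_le_edges[where r = "vx (tour_at 1)" and R = kept_adj and ends = "\<lambda>e. vx ` e"])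
    show "finite (edges s - cycle_edges)" using finE by simp
    show "vx (tour_at 1) \<in> vertices s" by simp
    show "(vx (tour_at 1), v) \<in> kept_adj\<^sup>*" if "v \<in> vertices s" for v
      using that by (rule all_vertices_connected)
    fix u v assume "(u, v) \<in> kept_adj"
    then obtain c where c: "c \<in> E" "edge_of s c \<notin> cycle_edges" "u = vx c" "v = vx (mate c)"
      by (auto simp: kept_adj_def)
    then have "vx ` edge_of s c = {u, v}" by (auto simp: edge_of_eq)
    then show "\<exists>e\<in>edges s - cycle_edges. vx ` e = {u, v}" using c by (auto simp: edges_def)
  qed
  also have "card (edges s - cycle_edges) = card (edges s) - card cycle_edges"
    using sub finE finite_subset by (intro card_Diff_subset) auto
  finally have "card (vertices s) + card cycle_edges \<le> card (edges s) + 1"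
    using card_mono[OF finE sub] by linarith
  then have "int (total_cycle_length s l) \<le> 2 - euler_characteristic s"
    using unicellular by (simp add: total_cycle_length_eq euler_characteristic_def unicellular_def)
  then have "(of_int (int (total_cycle_length s l)) :: rat) \<le> of_int (2 - euler_characteristic s)"
    by (simp only: of_int_le_iff)
  then show ?thesis by (simp add: genus_def)
qed

end

theorem theorem5p4:
  fixes s :: "'a pre_blossoming_map"
  assumes "unlabeled_scheme s" and "four_valent s"
  shows "\<forall>l. labeled_scheme s l \<longrightarrow>
     (\<forall>p. offset_cycle s l p \<longrightarrow>
        length p \<le> 2 \<and> (\<forall>e\<in>set p. forward_edge s e) \<and> sublist p (tour_edges s)) \<and>
     (orientable s \<longrightarrow> (\<nexists>p. offset_cycle s l p)) \<and>
     (\<forall>p q. offset_cycle s l p \<longrightarrow> offset_cycle s l q \<longrightarrow> set p \<noteq> set q \<longrightarrow>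
        cycle_vertices s l p \<inter> cycle_vertices s l q = {}) \<and>
     of_nat (total_cycle_length s l) \<le> 2 * genus s"
proof (intro allI impI)
  fix l assume "labeled_scheme s l"
  then interpret scheme s l
    using assms(2) by unfold_locales (auto simp: labeled_scheme_def scheme_map_def)
  show "(\<forall>p. offset_cycle s l p \<longrightarrow>
        length p \<le> 2 \<and> (\<forall>e\<in>set p. forward_edge s e) \<and> sublist p (tour_edges s)) \<and>
     (orientable s \<longrightarrow> (\<nexists>p. offset_cycle s l p)) \<and>
     (\<forall>p q. offset_cycle s l p \<longrightarrow> offset_cycle s l q \<longrightarrow> set p \<noteq> set q \<longrightarrow>
        cycle_vertices s l p \<inter> cycle_vertices s l q = {}) \<and>
     of_nat (total_cycle_length s l) \<le> 2 * genus s"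
    using offset_cycle_forward orientable_no_offset_cycle offset_cycles_disjoint
      total_cycle_length_le_genus by blast
qed

end
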